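(* Let $R\subset S$ be an integral FCP extension of commutative rings. Set $T:=\bigcap\{U\in[R,S]\mid U\subseteq S\text{ is infra-integral}\}$. Then the following conditions are equivalent: (1) the co-infra-integral closure of $R\subset S$ exists; (2) $T\subseteq S$ is infra-integral; (3) $T\subseteq S$ is catenarian. If these conditions hold, then $T$ is the co-infra-integral closure of $R\subset S$.
   Context: All rings are commutative and unital; $\subset$ denotes proper inclusion. $[R,S]$ is the set of all $R$-subalgebras of $S$, ordered by inclusion; $R\subseteq S$ has FCP if each chain in $[R,S]$ is finite. An FCP extension $T\subseteq S$ is catenarian if all maximal chains of $[T,S]$ have the same length. An integral extension $U\subseteq S$ is infra-integral if all its residual field extensions $\kappa_U(Q\cap U)\to\kappa_S(Q)$ ($Q\in\mathrm{Spec}(S)$) are isomorphisms. The co-infra-integral closure of $R\subseteq S$, if it exists, is the least $V\in[R,S]$ such that $V\subseteq S$ is infra-integral. *)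

theory Defs
  imports "HOL-Algebra.Algebra"
begin

section \<open>Extensions, chains\<close>

text \<open>
  A ring extension is a commutative ring \<open>S\<close> together with a subring \<open>U\<close> of it, given by the
  carrier set of \<open>U\<close>; as a ring in its own right the subring is \<open>S\<lparr>carrier := U\<rparr>\<close>.
  An \<open>R\<close>-subalgebra of \<open>S\<close> is a subring (with the same unit) containing \<open>R\<close>; the library's
  \<^term>\<open>subalgebra\<close> is a different notion, since it need not contain the unit nor be closed under
  products.
\<close>

definition interm_rings :: "'a set \<Rightarrow> ('a, 'b) ring_scheme \<Rightarrow> 'a set set" where
  "interm_rings R S = {U. subring U S \<and> R \<subseteq> U}"

definition FCP :: "'a set \<Rightarrow> ('a, 'b) ring_scheme \<Rightarrow> bool" where
  "FCP R S \<longleftrightarrow> (\<forall>C. subset.chain (interm_rings R S) C \<longrightarrow> finite C)"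

definition chain_length :: "'a set set \<Rightarrow> nat" where
  "chain_length C = card C - 1"

definition catenarian :: "'a set \<Rightarrow> ('a, 'b) ring_scheme \<Rightarrow> bool" where
  "catenarian T S \<longleftrightarrow> FCP T S \<and>
     (\<forall>C D. subset.maxchain (interm_rings T S) C \<longrightarrow> subset.maxchain (interm_rings T S) D \<longrightarrow>
        chain_length C = chain_length D)"

text \<open>
  Polynomials are coefficient lists with the leading coefficient first, so \<open>\<one> # cs\<close> is monic.
\<close>

definition integral_extension :: "'a set \<Rightarrow> ('a, 'b) ring_scheme \<Rightarrow> bool" where
  "integral_extension U S \<longleftrightarrow>
     (\<forall>x \<in> carrier S. \<exists>cs. set cs \<subseteq> U \<and> ring.eval S (\<one>\<^bsub>S\<^esub> # cs) x = \<zero>\<^bsub>S\<^esub>)"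


section \<open>Fraction field of a domain\<close>

definition frac_pairs :: "('a, 'b) ring_scheme \<Rightarrow> ('a \<times> 'a) set" where
  "frac_pairs D = carrier D \<times> (carrier D - {\<zero>\<^bsub>D\<^esub>})"

definition frac_rel :: "('a, 'b) ring_scheme \<Rightarrow> (('a \<times> 'a) \<times> ('a \<times> 'a)) set" where
  "frac_rel D = {((a, s), (b, t)). (a, s) \<in> frac_pairs D \<and> (b, t) \<in> frac_pairs D \<and>
     a \<otimes>\<^bsub>D\<^esub> t = b \<otimes>\<^bsub>D\<^esub> s}"

definition fraction :: "('a, 'b) ring_scheme \<Rightarrow> 'a \<Rightarrow> 'a \<Rightarrow> ('a \<times> 'a) set" where
  "fraction D a s = frac_rel D `` {(a, s)}"

definition frac_field :: "('a, 'b) ring_scheme \<Rightarrow> ('a \<times> 'a) set ring" where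
  "frac_field D =
    \<lparr>carrier = frac_pairs D // frac_rel D,
     monoid.mult = (\<lambda>A B. \<Union>(a, s) \<in> A. \<Union>(b, t) \<in> B. fraction D (a \<otimes>\<^bsub>D\<^esub> b) (s \<otimes>\<^bsub>D\<^esub> t)),
     one = fraction D \<one>\<^bsub>D\<^esub> \<one>\<^bsub>D\<^esub>,
     ring.zero = fraction D \<zero>\<^bsub>D\<^esub> \<one>\<^bsub>D\<^esub>,
     add = (\<lambda>A B. \<Union>(a, s) \<in> A. \<Union>(b, t) \<in> B.
              fraction D (a \<otimes>\<^bsub>D\<^esub> t \<oplus>\<^bsub>D\<^esub> b \<otimes>\<^bsub>D\<^esub> s) (s \<otimes>\<^bsub>D\<^esub> t))\<rparr>"

definition frac_map :: "('c, 'd) ring_scheme \<Rightarrow> ('a \<Rightarrow> 'c) \<Rightarrow> ('a \<times> 'a) set \<Rightarrow> ('c \<times> 'c) set" where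
  "frac_map E h A = (\<Union>(a, s) \<in> A. fraction E (h a) (h s))"


section \<open>Residual field extensions and infra-integrality\<close>

definition residue_field :: "('a, 'b) ring_scheme \<Rightarrow> 'a set \<Rightarrow> ('a set \<times> 'a set) set ring" where
  "residue_field M P = frac_field (M Quot P)"

text \<open>
  The map \<open>U/(Q \<inter> U) \<rightarrow> S/Q\<close> sends the coset of \<open>u\<close> to the coset of \<open>u\<close>.
\<close>

definition quot_map :: "('a, 'b) ring_scheme \<Rightarrow> 'a set \<Rightarrow> 'a set \<Rightarrow> 'a set" where
  "quot_map S Q A = (\<Union>u \<in> A. Q +>\<^bsub>S\<^esub> u)"

definition residual_map ::
  "('a, 'b) ring_scheme \<Rightarrow> 'a set \<Rightarrow> ('a set \<times> 'a set) set \<Rightarrow> ('a set \<times> 'a set) set" where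
  "residual_map S Q = frac_map (S Quot Q) (quot_map S Q)"

definition infra_integral :: "'a set \<Rightarrow> ('a, 'b) ring_scheme \<Rightarrow> bool" where
  "infra_integral U S \<longleftrightarrow> integral_extension U S \<and>
     (\<forall>Q. primeideal Q S \<longrightarrow>
        residual_map S Q \<in>
          ring_iso (residue_field (S\<lparr>carrier := U\<rparr>) (Q \<inter> U)) (residue_field S Q))"

definition is_co_infra_integral_closure :: "'a set \<Rightarrow> ('a, 'b) ring_scheme \<Rightarrow> 'a set \<Rightarrow> bool" where
  "is_co_infra_integral_closure R S V \<longleftrightarrow>
     V \<in> interm_rings R S \<and> infra_integral V S \<and>
     (\<forall>W \<in> interm_rings R S. infra_integral W S \<longrightarrow> V \<subseteq> W)"

end

theory Submission
  imports Defs
begin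

text \<open>
  Residual isomorphisms are handled elementwise: \<open>\<kappa>\<^sub>U(Q \<inter> U) \<rightarrow> \<kappa>\<^sub>S(Q)\<close> is always injective, and it is onto
  iff every \<open>y \<in> S\<close> admits \<open>s \<in> U - Q\<close> and \<open>b \<in> U\<close> with \<open>s y - b \<in> Q\<close>.

  The basic fact is that a minimal step \<open>B \<subset> C\<close> of an infra-integral extension has the form
  \<open>C = B + B x\<close>, where the conductor \<open>I\<close> of \<open>B\<close> in \<open>C\<close> is maximal in \<open>B\<close> and \<open>x\<^sup>2 \<in> I\<close> or \<open>x\<^sup>2 - x \<in> I\<close>.
  If \<open>T \<subseteq> S\<close> is infra-integral then \<open>B = T + I\<close>, so \<open>C/B\<close> is a simple \<open>T\<close>-module and a
  Jordan--Hoelder argument shows that \<open>T \<subseteq> S\<close> is catenarian.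

  Conversely let \<open>T \<subseteq> S\<close> be catenarian, \<open>U \<subseteq> S\<close> infra-integral and \<open>T \<subseteq> V \<subseteq> U\<close>. For a minimal step
  \<open>B \<subset> C\<close> above \<open>U\<close> one must have \<open>V + I = B\<close>, since otherwise a maximal chain through
  \<open>V + I \<subset> B \<subset> C\<close> could be traded for a longer one passing through the rings \<open>F + B x\<close>. Hence
  \<open>V \<subseteq> S\<close> is residually trivial at all primes containing the conductor of \<open>U\<close> in \<open>S\<close>. It follows that
  the infra-integral members of \<open>[T, S]\<close> are closed under intersection, and by the descending chain
  condition \<open>T\<close> is one of them.
\<close>

section \<open>Fraction fields and residual maps\<close>

lemma (in domain) equiv_frac_rel: "equiv (frac_pairs R) (frac_rel R)"
proof (rule equivI)
  show "refl_on (frac_pairs R) (frac_rel R)"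
    unfolding refl_on_def frac_rel_def by auto
  show "frac_rel R \<subseteq> frac_pairs R \<times> frac_pairs R"
    unfolding frac_rel_def by auto
  show "sym (frac_rel R)"
    unfolding sym_def frac_rel_def by auto
  show "trans (frac_rel R)"
  proof (rule transI)
    fix p q r assume "(p, q) \<in> frac_rel R" "(q, r) \<in> frac_rel R"
    then obtain a s b t c u where *: "p = (a, s)" "q = (b, t)" "r = (c, u)"
        "(a, s) \<in> frac_pairs R" "(b, t) \<in> frac_pairs R" "(c, u) \<in> frac_pairs R"
        and eqs: "a \<otimes> t = b \<otimes> s" "b \<otimes> u = c \<otimes> t"
      unfolding frac_rel_def by auto
    then have car: "a \<in> carrier R" "b \<in> carrier R" "c \<in> carrier R" "s \<in> carrier R"
        "t \<in> carrier R" "u \<in> carrier R" and "t \<noteq> \<zero>"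
      unfolding frac_pairs_def by auto
    have "t \<otimes> (a \<otimes> u) = (a \<otimes> t) \<otimes> u" using car by algebra
    also have "\<dots> = (b \<otimes> u) \<otimes> s" unfolding eqs(1) using car by algebra
    also have "\<dots> = t \<otimes> (c \<otimes> s)" unfolding eqs(2) using car by algebra
    finally have "a \<otimes> u = c \<otimes> s"
      using m_lcancel[OF \<open>t \<noteq> \<zero>\<close>] car by simp
    then show "(p, r) \<in> frac_rel R"
      using * unfolding frac_rel_def by auto
  qed
qed

lemma (in domain) fraction_eq_iff:
  assumes "(a, s) \<in> frac_pairs R" "(b, t) \<in> frac_pairs R"
  shows "fraction R a s = fraction R b t \<longleftrightarrow> a \<otimes> t = b \<otimes> s"
  using eq_equiv_class_iff[OF equiv_frac_rel assms] assms
  unfolding fraction_def frac_rel_def by auto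

lemma (in domain) mem_fraction_iff:
  assumes "(a, s) \<in> frac_pairs R"
  shows "(b, t) \<in> fraction R a s \<longleftrightarrow> (b, t) \<in> frac_pairs R \<and> a \<otimes> t = b \<otimes> s"
  using assms unfolding fraction_def frac_rel_def by auto

lemma (in domain) carrier_frac_field:
  "carrier (frac_field R) = {fraction R a s | a s. (a, s) \<in> frac_pairs R}"
  unfolding frac_field_def fraction_def quotient_def by auto

text \<open>Operations on fractions are encoded as unions over all representatives. Such a union
  collapses to its value at one representative as soon as the family is constant on the class; every
  well-definedness check below goes through this.\<close>

lemma (in domain) UN_fraction:
  assumes "(a, s) \<in> frac_pairs R"
    and "\<And>b t. (b, t) \<in> frac_pairs R \<Longrightarrow> a \<otimes> t = b \<otimes> s \<Longrightarrow> F b t = F a s"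
  shows "(\<Union>(b, t) \<in> fraction R a s. F b t) = F a s"
proof -
  have "(a, s) \<in> fraction R a s"
    using assms(1) mem_fraction_iff by blast
  moreover have "F b t = F a s" if "(b, t) \<in> fraction R a s" for b t
    using that assms mem_fraction_iff by blast
  ultimately show ?thesis by blast
qed

lemma (in domain) frac_pairs_mult:
  assumes "(a, s) \<in> frac_pairs R" "(b, t) \<in> frac_pairs R"
  shows "(a \<otimes> b, s \<otimes> t) \<in> frac_pairs R"
  using assms integral unfolding frac_pairs_def by auto

lemma (in domain) frac_pairs_add:
  assumes "(a, s) \<in> frac_pairs R" "(b, t) \<in> frac_pairs R"
  shows "(a \<otimes> t \<oplus> b \<otimes> s, s \<otimes> t) \<in> frac_pairs R"
  using assms integral unfolding frac_pairs_def by auto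

lemma (in domain) fraction_mult:
  assumes "(a, s) \<in> frac_pairs R" "(b, t) \<in> frac_pairs R"
  shows "fraction R a s \<otimes>\<^bsub>frac_field R\<^esub> fraction R b t = fraction R (a \<otimes> b) (s \<otimes> t)"
proof -
  \<comment> \<open>Representatives are exchanged one factor at a time. The pair
    \<open>(a', s')\<close> stays arbitrary because the outer union needs the collapsed inner union
    at every representative of the first factor.\<close>
  have inner: "(\<Union>(b', t') \<in> fraction R b t. fraction R (a' \<otimes> b') (s' \<otimes> t'))
      = fraction R (a' \<otimes> b) (s' \<otimes> t)" if as': "(a', s') \<in> frac_pairs R" for a' s'
  proof (rule UN_fraction[OF assms(2)])
    fix b' t' assume bt': "(b', t') \<in> frac_pairs R" "b \<otimes> t' = b' \<otimes> t"
    have car: "a' \<in> carrier R" "s' \<in> carrier R" "b \<in> carrier R" "t \<in> carrier R"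
        "b' \<in> carrier R" "t' \<in> carrier R"
      using as' bt' assms unfolding frac_pairs_def by auto
    have "(a' \<otimes> b') \<otimes> (s' \<otimes> t) = (a' \<otimes> s') \<otimes> (b' \<otimes> t)" using car by algebra
    also have "\<dots> = (a' \<otimes> b) \<otimes> (s' \<otimes> t')" unfolding bt'(2)[symmetric] using car by algebra
    finally show "fraction R (a' \<otimes> b') (s' \<otimes> t') = fraction R (a' \<otimes> b) (s' \<otimes> t)"
      using fraction_eq_iff frac_pairs_mult as' bt' assms by simp
  qed
  have "(\<Union>(a', s') \<in> fraction R a s. \<Union>(b', t') \<in> fraction R b t. fraction R (a' \<otimes> b') (s' \<otimes> t'))
      = (\<Union>(b', t') \<in> fraction R b t. fraction R (a \<otimes> b') (s \<otimes> t'))"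
  proof (rule UN_fraction[OF assms(1)])
    fix a' s' assume as': "(a', s') \<in> frac_pairs R" "a \<otimes> s' = a' \<otimes> s"
    have car: "a' \<in> carrier R" "s' \<in> carrier R" "b \<in> carrier R" "t \<in> carrier R"
        "a \<in> carrier R" "s \<in> carrier R"
      using as' assms unfolding frac_pairs_def by auto
    have "(a' \<otimes> b) \<otimes> (s \<otimes> t) = (a' \<otimes> s) \<otimes> (b \<otimes> t)" using car by algebra
    also have "\<dots> = (a \<otimes> b) \<otimes> (s' \<otimes> t)" unfolding as'(2)[symmetric] using car by algebra
    finally show "(\<Union>(b', t') \<in> fraction R b t. fraction R (a' \<otimes> b') (s' \<otimes> t'))
        = (\<Union>(b', t') \<in> fraction R b t. fraction R (a \<otimes> b') (s \<otimes> t'))"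
      using inner fraction_eq_iff frac_pairs_mult as' assms by simp
  qed
  then show ?thesis
    using inner[OF assms(1)] unfolding frac_field_def by simp
qed

lemma (in domain) fraction_add:
  assumes "(a, s) \<in> frac_pairs R" "(b, t) \<in> frac_pairs R"
  shows "fraction R a s \<oplus>\<^bsub>frac_field R\<^esub> fraction R b t
    = fraction R (a \<otimes> t \<oplus> b \<otimes> s) (s \<otimes> t)"
proof -
  have inner: "(\<Union>(b', t') \<in> fraction R b t. fraction R (a' \<otimes> t' \<oplus> b' \<otimes> s') (s' \<otimes> t'))
      = fraction R (a' \<otimes> t \<oplus> b \<otimes> s') (s' \<otimes> t)" if as': "(a', s') \<in> frac_pairs R" for a' s'
  proof (rule UN_fraction[OF assms(2)])
    fix b' t' assume bt': "(b', t') \<in> frac_pairs R" "b \<otimes> t' = b' \<otimes> t"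
    have car: "a' \<in> carrier R" "s' \<in> carrier R" "b \<in> carrier R" "t \<in> carrier R"
        "b' \<in> carrier R" "t' \<in> carrier R"
      using as' bt' assms unfolding frac_pairs_def by auto
    have "(a' \<otimes> t' \<oplus> b' \<otimes> s') \<otimes> (s' \<otimes> t) = a' \<otimes> s' \<otimes> t \<otimes> t' \<oplus> (b' \<otimes> t) \<otimes> s' \<otimes> s'"
      using car by algebra
    also have "\<dots> = (a' \<otimes> t \<oplus> b \<otimes> s') \<otimes> (s' \<otimes> t')"
      unfolding bt'(2)[symmetric] using car by algebra
    finally show "fraction R (a' \<otimes> t' \<oplus> b' \<otimes> s') (s' \<otimes> t') = fraction R (a' \<otimes> t \<oplus> b \<otimes> s') (s' \<otimes> t)"
      using fraction_eq_iff frac_pairs_add as' bt' assms by simp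
  qed
  have "(\<Union>(a', s') \<in> fraction R a s. \<Union>(b', t') \<in> fraction R b t.
        fraction R (a' \<otimes> t' \<oplus> b' \<otimes> s') (s' \<otimes> t'))
      = (\<Union>(b', t') \<in> fraction R b t. fraction R (a \<otimes> t' \<oplus> b' \<otimes> s) (s \<otimes> t'))"
  proof (rule UN_fraction[OF assms(1)])
    fix a' s' assume as': "(a', s') \<in> frac_pairs R" "a \<otimes> s' = a' \<otimes> s"
    have car: "a' \<in> carrier R" "s' \<in> carrier R" "b \<in> carrier R" "t \<in> carrier R"
        "a \<in> carrier R" "s \<in> carrier R"
      using as' assms unfolding frac_pairs_def by auto
    have "(a' \<otimes> t \<oplus> b \<otimes> s') \<otimes> (s \<otimes> t) = (a' \<otimes> s) \<otimes> t \<otimes> t \<oplus> b \<otimes> t \<otimes> s \<otimes> s'"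
      using car by algebra
    also have "\<dots> = (a \<otimes> t \<oplus> b \<otimes> s) \<otimes> (s' \<otimes> t)"
      unfolding as'(2)[symmetric] using car by algebra
    finally show "(\<Union>(b', t') \<in> fraction R b t. fraction R (a' \<otimes> t' \<oplus> b' \<otimes> s') (s' \<otimes> t'))
        = (\<Union>(b', t') \<in> fraction R b t. fraction R (a \<otimes> t' \<oplus> b' \<otimes> s) (s \<otimes> t'))"
      using inner fraction_eq_iff frac_pairs_add as' assms by simp
  qed
  then show ?thesis
    using inner[OF assms(1)] unfolding frac_field_def by simp
qed

text \<open>An injective homomorphism of domains always induces an injective homomorphism of
  fraction fields, so only surjectivity is at stake. It suffices to reach the fractions
  \<open>y/1\<close>, since the image is closed under quotients.\<close>

lemma frac_map_ring_iso_iff: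
  fixes D :: "('a, 'b) ring_scheme" and E :: "('c, 'd) ring_scheme"
  assumes "domain D" "domain E" and hom: "h \<in> ring_hom D E" and inj: "inj_on h (carrier D)"
  shows "frac_map E h \<in> ring_iso (frac_field D) (frac_field E) \<longleftrightarrow>
    (\<forall>y \<in> carrier E. \<exists>a \<in> carrier D. \<exists>s \<in> carrier D - {\<zero>\<^bsub>D\<^esub>}. h s \<otimes>\<^bsub>E\<^esub> y = h a)"
proof -
  interpret D: domain D by fact
  interpret E: domain E by fact
  interpret h: ring_hom_cring D E h
    using hom by unfold_locales auto
  have pairs: "(h a, h s) \<in> frac_pairs E" if "(a, s) \<in> frac_pairs D" for a s
    using that inj unfolding frac_pairs_def
    by (auto simp: inj_on_eq_iff[OF inj, of s "\<zero>\<^bsub>D\<^esub>", simplified])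
  have fm: "frac_map E h (fraction D a s) = fraction E (h a) (h s)"
    if "(a, s) \<in> frac_pairs D" for a s
    unfolding frac_map_def
  proof (rule D.UN_fraction[OF that])
    fix b t assume bt: "(b, t) \<in> frac_pairs D" "a \<otimes>\<^bsub>D\<^esub> t = b \<otimes>\<^bsub>D\<^esub> s"
    then have "h b \<otimes>\<^bsub>E\<^esub> h s = h a \<otimes>\<^bsub>E\<^esub> h t"
      using that unfolding frac_pairs_def by (auto simp flip: h.hom_mult)
    then show "fraction E (h b) (h t) = fraction E (h a) (h s)"
      using E.fraction_eq_iff pairs that bt by blast
  qed
  have one: "(\<one>\<^bsub>D\<^esub>, \<one>\<^bsub>D\<^esub>) \<in> frac_pairs D" "\<one>\<^bsub>frac_field D\<^esub> = fraction D \<one>\<^bsub>D\<^esub> \<one>\<^bsub>D\<^esub>"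
      "\<one>\<^bsub>frac_field E\<^esub> = fraction E \<one>\<^bsub>E\<^esub> \<one>\<^bsub>E\<^esub>"
    unfolding frac_pairs_def frac_field_def by auto
  have car: "a \<in> carrier D" "s \<in> carrier D" if "(a, s) \<in> frac_pairs D" for a s
    using that unfolding frac_pairs_def by auto
  have hom': "frac_map E h \<in> ring_hom (frac_field D) (frac_field E)"
  proof (rule ring_hom_memI)
    fix x assume "x \<in> carrier (frac_field D)"
    then show "frac_map E h x \<in> carrier (frac_field E)"
      using fm pairs unfolding D.carrier_frac_field E.carrier_frac_field by fastforce
  next
    fix x y assume "x \<in> carrier (frac_field D)" "y \<in> carrier (frac_field D)"
    then obtain a s b t where
      x: "x = fraction D a s" "(a, s) \<in> frac_pairs D" and
      y: "y = fraction D b t" "(b, t) \<in> frac_pairs D"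
      unfolding D.carrier_frac_field by auto
    show "frac_map E h (x \<otimes>\<^bsub>frac_field D\<^esub> y) = frac_map E h x \<otimes>\<^bsub>frac_field E\<^esub> frac_map E h y"
      using x y by (simp add: fm D.fraction_mult E.fraction_mult pairs D.frac_pairs_mult car)
    show "frac_map E h (x \<oplus>\<^bsub>frac_field D\<^esub> y) = frac_map E h x \<oplus>\<^bsub>frac_field E\<^esub> frac_map E h y"
      using x y by (simp add: fm D.fraction_add E.fraction_add pairs D.frac_pairs_add car)
  next
    show "frac_map E h \<one>\<^bsub>frac_field D\<^esub> = \<one>\<^bsub>frac_field E\<^esub>"
      using fm one by simp
  qed
  have inj': "inj_on (frac_map E h) (carrier (frac_field D))"
  proof (rule inj_onI)
    fix x y assume "x \<in> carrier (frac_field D)" "y \<in> carrier (frac_field D)"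
      and eq: "frac_map E h x = frac_map E h y"
    then obtain a s b t where
      x: "x = fraction D a s" "(a, s) \<in> frac_pairs D" and
      y: "y = fraction D b t" "(b, t) \<in> frac_pairs D"
      unfolding D.carrier_frac_field by auto
    have "h a \<otimes>\<^bsub>E\<^esub> h t = h b \<otimes>\<^bsub>E\<^esub> h s"
      using eq x y fm pairs E.fraction_eq_iff by auto
    then have "h (a \<otimes>\<^bsub>D\<^esub> t) = h (b \<otimes>\<^bsub>D\<^esub> s)"
      using car x y by simp
    then have "a \<otimes>\<^bsub>D\<^esub> t = b \<otimes>\<^bsub>D\<^esub> s"
      using inj_onD[OF inj] car x y by simp
    then show "x = y"
      using x y D.fraction_eq_iff by simp
  qed
  have "frac_map E h \<in> ring_iso (frac_field D) (frac_field E) \<longleftrightarrow>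
      carrier (frac_field E) \<subseteq> frac_map E h ` carrier (frac_field D)"
    using hom' inj' ring_hom_closed[OF hom'] unfolding ring_iso_def bij_betw_def by auto
  also have "\<dots> \<longleftrightarrow>
    (\<forall>y \<in> carrier E. \<exists>a \<in> carrier D. \<exists>s \<in> carrier D - {\<zero>\<^bsub>D\<^esub>}. h s \<otimes>\<^bsub>E\<^esub> y = h a)"
  proof
    assume surj: "carrier (frac_field E) \<subseteq> frac_map E h ` carrier (frac_field D)"
    show "\<forall>y \<in> carrier E. \<exists>a \<in> carrier D. \<exists>s \<in> carrier D - {\<zero>\<^bsub>D\<^esub>}. h s \<otimes>\<^bsub>E\<^esub> y = h a"
    proof
      fix y assume y: "y \<in> carrier E"
      then have y1: "(y, \<one>\<^bsub>E\<^esub>) \<in> frac_pairs E" unfolding frac_pairs_def by simp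
      then have "fraction E y \<one>\<^bsub>E\<^esub> \<in> frac_map E h ` carrier (frac_field D)"
        using surj unfolding E.carrier_frac_field by auto
      then obtain a s where as: "(a, s) \<in> frac_pairs D" "fraction E y \<one>\<^bsub>E\<^esub> = fraction E (h a) (h s)"
        unfolding D.carrier_frac_field using fm by auto
      then have "y \<otimes>\<^bsub>E\<^esub> h s = h a \<otimes>\<^bsub>E\<^esub> \<one>\<^bsub>E\<^esub>"
        using E.fraction_eq_iff[OF y1 pairs] by simp
      then have "h s \<otimes>\<^bsub>E\<^esub> y = h a"
        using car[OF as(1)] y by (simp add: E.m_comm)
      then show "\<exists>a \<in> carrier D. \<exists>s \<in> carrier D - {\<zero>\<^bsub>D\<^esub>}. h s \<otimes>\<^bsub>E\<^esub> y = h a"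
        using as(1) unfolding frac_pairs_def by auto
    qed
  next
    assume ex: "\<forall>y \<in> carrier E. \<exists>a \<in> carrier D. \<exists>s \<in> carrier D - {\<zero>\<^bsub>D\<^esub>}. h s \<otimes>\<^bsub>E\<^esub> y = h a"
    show "carrier (frac_field E) \<subseteq> frac_map E h ` carrier (frac_field D)"
    proof
      fix z assume "z \<in> carrier (frac_field E)"
      then obtain y w where yw: "z = fraction E y w" "(y, w) \<in> frac_pairs E"
        unfolding E.carrier_frac_field by auto
      then have yw': "y \<in> carrier E" "w \<in> carrier E" "w \<noteq> \<zero>\<^bsub>E\<^esub>"
        unfolding frac_pairs_def by auto
      \<comment> \<open>With \<open>y\<close> equal to \<open>h a / h s\<close> and \<open>w\<close>
        to \<open>h b / h t\<close>, the fraction \<open>y/w\<close> is the image of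
        \<open>(a t)/(b s)\<close>; \<open>b\<close> is nonzero because \<open>h t\<close> and
        \<open>w\<close> are.\<close>
      obtain a s where as: "a \<in> carrier D" "s \<in> carrier D - {\<zero>\<^bsub>D\<^esub>}" "h s \<otimes>\<^bsub>E\<^esub> y = h a"
        using ex yw' by blast
      obtain b t where bt: "b \<in> carrier D" "t \<in> carrier D - {\<zero>\<^bsub>D\<^esub>}" "h t \<otimes>\<^bsub>E\<^esub> w = h b"
        using ex yw' by blast
      have "h t \<noteq> \<zero>\<^bsub>E\<^esub>"
        using pairs[of a t] as bt unfolding frac_pairs_def by auto
      then have "h b \<noteq> \<zero>\<^bsub>E\<^esub>"
        using E.integral[of "h t" w] bt yw' by auto
      then have "b \<noteq> \<zero>\<^bsub>D\<^esub>" by auto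
      have p: "(a \<otimes>\<^bsub>D\<^esub> t, b \<otimes>\<^bsub>D\<^esub> s) \<in> frac_pairs D"
        using as bt \<open>b \<noteq> \<zero>\<^bsub>D\<^esub>\<close> D.integral unfolding frac_pairs_def by auto
      have c: "h s \<in> carrier E" "h t \<in> carrier E" using as bt by auto
      have "y \<otimes>\<^bsub>E\<^esub> h (b \<otimes>\<^bsub>D\<^esub> s) = y \<otimes>\<^bsub>E\<^esub> ((h t \<otimes>\<^bsub>E\<^esub> w) \<otimes>\<^bsub>E\<^esub> h s)"
        using as bt by simp
      also have "\<dots> = (h s \<otimes>\<^bsub>E\<^esub> y) \<otimes>\<^bsub>E\<^esub> h t \<otimes>\<^bsub>E\<^esub> w"
        using c yw' by (simp add: E.m_ac)
      also have "\<dots> = h (a \<otimes>\<^bsub>D\<^esub> t) \<otimes>\<^bsub>E\<^esub> w"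
        using as bt by simp
      finally have "z = frac_map E h (fraction D (a \<otimes>\<^bsub>D\<^esub> t) (b \<otimes>\<^bsub>D\<^esub> s))"
        using yw fm[OF p] E.fraction_eq_iff[OF yw(2) pairs[OF p]] by simp
      then show "z \<in> frac_map E h ` carrier (frac_field D)"
        using p unfolding D.carrier_frac_field by blast
    qed
  qed
  finally show ?thesis .
qed

section \<open>Residual triviality, the elementwise form of surjectivity on residue fields\<close>

definition residually_trivial_at :: "'a set \<Rightarrow> ('a, 'b) ring_scheme \<Rightarrow> 'a set \<Rightarrow> bool" where
  "residually_trivial_at U S Q \<longleftrightarrow>
     (\<forall>y \<in> carrier S. \<exists>s \<in> U - Q. \<exists>b \<in> U. s \<otimes>\<^bsub>S\<^esub> y \<ominus>\<^bsub>S\<^esub> b \<in> Q)"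

lemma (in cring) subring_cring:
  assumes "subring U R" shows "cring (R\<lparr>carrier := U\<rparr>)"
  using subcring_iff[OF subringE(1)[OF assms]] subcringI'[OF assms] by blast

lemma (in cring) ideal_memI:
  assumes "I \<subseteq> carrier R" "\<zero> \<in> I"
    and add: "\<And>a b. a \<in> I \<Longrightarrow> b \<in> I \<Longrightarrow> a \<oplus> b \<in> I"
    and mult: "\<And>a r. a \<in> I \<Longrightarrow> r \<in> carrier R \<Longrightarrow> r \<otimes> a \<in> I"
  shows "ideal I R"
proof (rule idealI)
  show "ring R" by (rule ring_axioms)
  show "subgroup I (add_monoid R)"
  proof (rule add.subgroupI)
    fix a assume a: "a \<in> I"
    then have "\<ominus> a = (\<ominus> \<one>) \<otimes> a" using assms(1) l_minus by auto
    then show "\<ominus> a \<in> I" using mult[OF a] by simp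
  qed (use assms in auto)
next
  fix a r assume a: "a \<in> I" "r \<in> carrier R"
  then show "r \<otimes> a \<in> I" by (rule mult)
  then show "a \<otimes> r \<in> I" using a assms(1) m_comm by auto
qed

lemma (in ring) subring_minus_consistent:
  assumes "subring U R" "x \<in> U" "y \<in> U"
  shows "x \<ominus>\<^bsub>R\<lparr>carrier := U\<rparr>\<^esub> y = x \<ominus> y"
proof -
  have "\<ominus>\<^bsub>R\<lparr>carrier := U\<rparr>\<^esub> y = \<ominus> y"
    using add.m_inv_consistent[OF subring.axioms(1)[OF assms(1)] assms(3)]
    unfolding a_inv_def by simp
  then show ?thesis unfolding a_minus_def by simp
qed

lemma (in ring) subring_minus_closed:
  assumes "subring U R" "x \<in> U" "y \<in> U"
  shows "x \<ominus> y \<in> U"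
  using subringE[OF assms(1)] assms(2,3) unfolding a_minus_def by auto

lemma (in cring) primeideal_inter_subring:
  assumes "primeideal Q R" "subring U R"
  shows "primeideal (Q \<inter> U) (R\<lparr>carrier := U\<rparr>)"
proof -
  interpret Q: primeideal Q R by fact
  interpret U: cring "R\<lparr>carrier := U\<rparr>" using subring_cring assms by blast
  show ?thesis
  proof (rule primeidealI)
    show "ideal (Q \<inter> U) (R\<lparr>carrier := U\<rparr>)"
      by (rule U.ideal_memI) (use subringE[OF assms(2)] Q.I_l_closed in auto)
    show "cring (R\<lparr>carrier := U\<rparr>)" by (rule U.is_cring)
    show "carrier (R\<lparr>carrier := U\<rparr>) \<noteq> Q \<inter> U"
      using Q.I_notcarr Q.one_imp_carrier subringE(3)[OF assms(2)] by auto
    show "\<And>a b. a \<in> carrier (R\<lparr>carrier := U\<rparr>) \<Longrightarrow> b \<in> carrier (R\<lparr>carrier := U\<rparr>) \<Longrightarrow>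
        a \<otimes>\<^bsub>R\<lparr>carrier := U\<rparr>\<^esub> b \<in> Q \<inter> U \<Longrightarrow> a \<in> Q \<inter> U \<or> b \<in> Q \<inter> U"
      using Q.I_prime subringE(1)[OF assms(2)] by auto
  qed
qed

text \<open>The map of residue rings is an injective homomorphism of domains, so
  \<open>frac_map_ring_iso_iff\<close> reduces the claim to a statement about cosets, which is then
  unwound to representatives.\<close>

lemma (in cring) residual_map_ring_iso_iff:
  assumes Q: "primeideal Q R" and U: "subring U R"
  shows "residual_map R Q \<in>
      ring_iso (residue_field (R\<lparr>carrier := U\<rparr>) (Q \<inter> U)) (residue_field R Q) \<longleftrightarrow>
    residually_trivial_at U R Q"
proof -
  let ?U = "R\<lparr>carrier := U\<rparr>" and ?P = "Q \<inter> U"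
  interpret Q: primeideal Q R by fact
  interpret P: primeideal ?P ?U using primeideal_inter_subring[OF assms] .
  note Ucar = subsetD[OF subringE(1)[OF U]]
  have carD: "carrier (?U Quot ?P) = {?P +>\<^bsub>?U\<^esub> u | u. u \<in> U}"
    unfolding FactRing_def A_RCOSETS_def' by auto
  have carE: "carrier (R Quot Q) = {Q +> u | u. u \<in> carrier R}"
    unfolding FactRing_def A_RCOSETS_def' by auto
  have eqE: "Q +> a = Q +> b \<longleftrightarrow> a \<ominus> b \<in> Q" if "a \<in> carrier R" "b \<in> carrier R" for a b
    using quotient_eq_iff_same_a_r_cos[OF Q.ideal_axioms that] by simp
  have eqD: "?P +>\<^bsub>?U\<^esub> a = ?P +>\<^bsub>?U\<^esub> b \<longleftrightarrow> a \<ominus> b \<in> Q" if "a \<in> U" "b \<in> U" for a b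
    using P.quotient_eq_iff_same_a_r_cos[OF P.ideal_axioms, of a b]
      subring_minus_closed[OF U that] subring_minus_consistent[OF U that] that by simp
  have h: "quot_map R Q (?P +>\<^bsub>?U\<^esub> u) = Q +> u" if u: "u \<in> U" for u
  proof -
    have "Q +> v = Q +> u" if v: "v \<in> ?P +>\<^bsub>?U\<^esub> u" for v
    proof -
      obtain q where q: "q \<in> Q" "q \<in> U" "v = q \<oplus> u"
        using v unfolding a_r_coset_def' by auto
      have "q \<oplus> u \<ominus> u = q" using Ucar q(2) u by algebra
      then show ?thesis
        using q u Ucar eqE by simp
    qed
    moreover have "u \<in> ?P +>\<^bsub>?U\<^esub> u" using P.a_rcos_self u by simp
    ultimately show ?thesis unfolding quot_map_def by blast
  qed
  have homD: "(+>\<^bsub>?U\<^esub>) ?P \<in> ring_hom ?U (?U Quot ?P)" by (rule P.rcos_ring_hom)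
  have homE: "(+>) Q \<in> ring_hom R (R Quot Q)" by (rule Q.rcos_ring_hom)
  have hom: "quot_map R Q \<in> ring_hom (?U Quot ?P) (R Quot Q)"
  proof (rule ring_hom_memI)
    fix x assume "x \<in> carrier (?U Quot ?P)"
    then show "quot_map R Q x \<in> carrier (R Quot Q)"
      unfolding carD carE using h Ucar by auto
  next
    fix x y assume "x \<in> carrier (?U Quot ?P)" "y \<in> carrier (?U Quot ?P)"
    then obtain u v where uv: "u \<in> U" "v \<in> U" "x = ?P +>\<^bsub>?U\<^esub> u" "y = ?P +>\<^bsub>?U\<^esub> v"
      unfolding carD by auto
    have "x \<otimes>\<^bsub>?U Quot ?P\<^esub> y = ?P +>\<^bsub>?U\<^esub> (u \<otimes> v)"
      using ring_hom_mult[OF homD, of u v] uv by simp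
    then show "quot_map R Q (x \<otimes>\<^bsub>?U Quot ?P\<^esub> y) = quot_map R Q x \<otimes>\<^bsub>R Quot Q\<^esub> quot_map R Q y"
      using h ring_hom_mult[OF homE] uv Ucar subringE(6)[OF U] by simp
    have "x \<oplus>\<^bsub>?U Quot ?P\<^esub> y = ?P +>\<^bsub>?U\<^esub> (u \<oplus> v)"
      using ring_hom_add[OF homD, of u v] uv by simp
    then show "quot_map R Q (x \<oplus>\<^bsub>?U Quot ?P\<^esub> y) = quot_map R Q x \<oplus>\<^bsub>R Quot Q\<^esub> quot_map R Q y"
      using h ring_hom_add[OF homE] uv Ucar subringE(7)[OF U] by simp
  next
    show "quot_map R Q \<one>\<^bsub>?U Quot ?P\<^esub> = \<one>\<^bsub>R Quot Q\<^esub>"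
      using h[OF subringE(3)[OF U]] ring_hom_one[OF homD] ring_hom_one[OF homE] by simp
  qed
  have inj: "inj_on (quot_map R Q) (carrier (?U Quot ?P))"
  proof (rule inj_onI)
    fix x y assume "x \<in> carrier (?U Quot ?P)" "y \<in> carrier (?U Quot ?P)"
      and eq: "quot_map R Q x = quot_map R Q y"
    then obtain u v where uv: "u \<in> U" "v \<in> U" "x = ?P +>\<^bsub>?U\<^esub> u" "y = ?P +>\<^bsub>?U\<^esub> v"
      unfolding carD by auto
    then show "x = y" using eq h eqE eqD Ucar by simp
  qed
  have zero: "?P +>\<^bsub>?U\<^esub> s = \<zero>\<^bsub>?U Quot ?P\<^esub> \<longleftrightarrow> s \<in> Q" if s: "s \<in> U" for s
  proof -
    have "\<zero>\<^bsub>?U Quot ?P\<^esub> = ?P +>\<^bsub>?U\<^esub> \<zero>"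
      using P.a_coset_add_zero[of ?P] subringE(1)[OF U] unfolding FactRing_def by auto
    moreover have "s \<ominus> \<zero> = s" using Ucar s by algebra
    ultimately show ?thesis using eqD[OF s subringE(2)[OF U]] by simp
  qed
  have eq: "(Q +> s) \<otimes>\<^bsub>R Quot Q\<^esub> (Q +> y) = Q +> b \<longleftrightarrow> s \<otimes> y \<ominus> b \<in> Q"
    if "s \<in> carrier R" "y \<in> carrier R" "b \<in> carrier R" for s y b
    unfolding ring_hom_mult[OF homE that(1,2), symmetric] using eqE that by simp
  have "residual_map R Q \<in> ring_iso (residue_field ?U ?P) (residue_field R Q) \<longleftrightarrow>
    (\<forall>y \<in> carrier (R Quot Q). \<exists>a \<in> carrier (?U Quot ?P).
       \<exists>s \<in> carrier (?U Quot ?P) - {\<zero>\<^bsub>?U Quot ?P\<^esub>}.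
         quot_map R Q s \<otimes>\<^bsub>R Quot Q\<^esub> y = quot_map R Q a)"
    unfolding residual_map_def residue_field_def
    by (rule frac_map_ring_iso_iff[OF P.quotient_is_domain Q.quotient_is_domain hom inj])
  also have "\<dots> \<longleftrightarrow> (\<forall>y \<in> carrier R. \<exists>b \<in> U. \<exists>s \<in> U. s \<notin> Q \<and>
         (Q +> s) \<otimes>\<^bsub>R Quot Q\<^esub> (Q +> y) = Q +> b)"
  proof -
    have D: "(\<exists>a \<in> carrier (?U Quot ?P). F a) \<longleftrightarrow> (\<exists>u \<in> U. F (?P +>\<^bsub>?U\<^esub> u))" for F
      unfolding carD by auto
    have D': "(\<exists>a \<in> carrier (?U Quot ?P) - {\<zero>\<^bsub>?U Quot ?P\<^esub>}. F a)
        \<longleftrightarrow> (\<exists>u \<in> U. u \<notin> Q \<and> F (?P +>\<^bsub>?U\<^esub> u))" for F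
      using zero unfolding carD by auto
    have E: "(\<forall>a \<in> carrier (R Quot Q). F a) \<longleftrightarrow> (\<forall>u \<in> carrier R. F (Q +> u))" for F
      unfolding carE by auto
    show ?thesis unfolding D D' E by (intro ball_cong bex_cong conj_cong refl) (simp add: h)
  qed
  also have "\<dots> \<longleftrightarrow> (\<forall>y \<in> carrier R. \<exists>b \<in> U. \<exists>s \<in> U. s \<notin> Q \<and> s \<otimes> y \<ominus> b \<in> Q)"
    by (intro ball_cong bex_cong conj_cong refl) (simp add: eq Ucar)
  also have "\<dots> \<longleftrightarrow> residually_trivial_at U R Q"
    unfolding residually_trivial_at_def by blast
  finally show ?thesis .
qed

lemma infra_integral_iff:
  assumes "cring S" "subring U S"
  shows "infra_integral U S \<longleftrightarrow>
    integral_extension U S \<and> (\<forall>Q. primeideal Q S \<longrightarrow> residually_trivial_at U S Q)"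
  using cring.residual_map_ring_iso_iff[OF assms(1) _ assms(2)]
  unfolding infra_integral_def by blast

section \<open>Prime ideals\<close>

lemma (in cring) ideal_adjoin:
  assumes "ideal Q R" "a \<in> carrier R"
  defines "J \<equiv> {q \<oplus> r \<otimes> a | q r. q \<in> Q \<and> r \<in> carrier R}"
  shows "ideal J R" "Q \<subseteq> J" "a \<in> J"
proof -
  interpret Q: ideal Q R by fact
  note car = assms(2) Q.a_Hcarr
  show "Q \<subseteq> J"
  proof
    fix q assume "q \<in> Q"
    moreover from this have "q = q \<oplus> \<zero> \<otimes> a" using car by simp
    ultimately show "q \<in> J" unfolding J_def by blast
  qed
  have "a = \<zero> \<oplus> \<one> \<otimes> a" using car by simp
  then show "a \<in> J" unfolding J_def using Q.zero_closed by blast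
  show "ideal J R"
  proof (rule ideal_memI)
    show "J \<subseteq> carrier R" unfolding J_def using car by auto
    show "\<zero> \<in> J" using \<open>Q \<subseteq> J\<close> Q.zero_closed by blast
    fix x assume "x \<in> J"
    then obtain q r where x: "x = q \<oplus> r \<otimes> a" "q \<in> Q" "r \<in> carrier R" unfolding J_def by blast
    have q: "q \<in> carrier R" using x car by blast
    show "x \<oplus> y \<in> J" if yJ: "y \<in> J" for y
    proof -
      obtain q' r' where y: "y = q' \<oplus> r' \<otimes> a" "q' \<in> Q" "r' \<in> carrier R"
        using yJ unfolding J_def by blast
      have "q' \<in> carrier R" using y car by blast
      then have "x \<oplus> y = (q \<oplus> q') \<oplus> (r \<oplus> r') \<otimes> a"
        unfolding x y using q x(3) y(3) assms(2) by algebra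
      then show ?thesis unfolding J_def using Q.a_closed x y by blast
    qed
    show "s \<otimes> x \<in> J" if "s \<in> carrier R" for s
    proof -
      have "s \<otimes> x = s \<otimes> q \<oplus> (s \<otimes> r) \<otimes> a"
        unfolding x using q x(3) that assms(2) by algebra
      then show ?thesis unfolding J_def using Q.I_l_closed x that by blast
    qed
  qed
qed

text \<open>Zorn's lemma yields an ideal maximal among those that contain \<open>I\<close> and miss
  the multiplicative set \<open>W\<close>, and maximality forces it to be prime. The maximality is
  exported too, because \<open>lying_over\<close> uses it once more.\<close>

lemma (in cring) exists_primeideal_avoiding:
  assumes I: "ideal I R" and W: "W \<subseteq> carrier R" "\<one> \<in> W"
    and mult: "\<And>x y. x \<in> W \<Longrightarrow> y \<in> W \<Longrightarrow> x \<otimes> y \<in> W" and disj: "I \<inter> W = {}"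
  obtains Q where "primeideal Q R" "I \<subseteq> Q" "Q \<inter> W = {}"
    "\<And>J. ideal J R \<Longrightarrow> Q \<subset> J \<Longrightarrow> J \<inter> W \<noteq> {}"
proof -
  let ?A = "{J. ideal J R \<and> I \<subseteq> J \<and> J \<inter> W = {}}"
  have "\<exists>M \<in> ?A. \<forall>J \<in> ?A. M \<subseteq> J \<longrightarrow> J = M"
  proof (rule subset_Zorn_nonempty)
    show "?A \<noteq> {}" using I disj by blast
    fix C assume C: "C \<noteq> {}" "subset.chain ?A C"
    then have "subset.chain {J. ideal J R} C"
      unfolding pred_on.chain_def by blast
    then have "ideal (\<Union>C) R"
      using chain_Union_is_ideal[of C] C(1) by simp
    then show "\<Union>C \<in> ?A"
      using C unfolding pred_on.chain_def by blast
  qed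
  then obtain Q where "Q \<in> ?A" and "\<forall>J \<in> ?A. Q \<subseteq> J \<longrightarrow> J = Q"
    by (elim bexE)
  then have Q: "ideal Q R" "I \<subseteq> Q" "Q \<inter> W = {}"
      and max: "\<And>J. ideal J R \<Longrightarrow> I \<subseteq> J \<Longrightarrow> J \<inter> W = {} \<Longrightarrow> Q \<subseteq> J \<Longrightarrow> J = Q"
    by auto
  interpret Q: ideal Q R by fact
  have max': "J \<inter> W \<noteq> {}" if "ideal J R" "Q \<subset> J" for J
    using max[of J] that Q by blast
  \<comment> \<open>Adjoining an element outside \<open>Q\<close> gives a strictly larger ideal,
    which meets \<open>W\<close>. For two elements outside \<open>Q\<close> with product in
    \<open>Q\<close>, the members of \<open>W\<close> so obtained have their product in
    \<open>Q\<close>, a contradiction.\<close>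
  have hit: "\<exists>q \<in> Q. \<exists>r \<in> carrier R. q \<oplus> r \<otimes> a \<in> W" if a: "a \<in> carrier R" "a \<notin> Q" for a
  proof -
    show ?thesis
      using max'[OF ideal_adjoin(1)[OF Q(1) a(1)]] ideal_adjoin(2,3)[OF Q(1) a(1)] a(2)
      by blast
  qed
  have "primeideal Q R"
  proof (rule primeidealI)
    show "ideal Q R" "cring R" by (rule Q) (rule is_cring)
    show "carrier R \<noteq> Q" using W Q(3) by blast
    fix a b assume ab: "a \<in> carrier R" "b \<in> carrier R" "a \<otimes> b \<in> Q"
    show "a \<in> Q \<or> b \<in> Q"
    proof (rule ccontr)
      assume "\<not> (a \<in> Q \<or> b \<in> Q)"
      then obtain p r q s where *: "p \<in> Q" "r \<in> carrier R" "p \<oplus> r \<otimes> a \<in> W"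
          "q \<in> Q" "s \<in> carrier R" "q \<oplus> s \<otimes> b \<in> W"
        using hit ab by meson
      have car: "p \<in> carrier R" "q \<in> carrier R" using * Q.a_Hcarr by auto
      have "(p \<oplus> r \<otimes> a) \<otimes> (q \<oplus> s \<otimes> b) = (q \<oplus> s \<otimes> b) \<otimes> p \<oplus> ((r \<otimes> a) \<otimes> q \<oplus> (r \<otimes> s) \<otimes> (a \<otimes> b))"
        using car * ab by algebra
      also have "\<dots> \<in> Q"
        using car * ab Q.I_l_closed[of "a \<otimes> b"] Q.I_l_closed[of p] Q.I_l_closed[of q]
        by (intro Q.a_closed) auto
      finally show False using mult[OF *(3,6)] Q(3) by blast
    qed
  qed
  then show ?thesis using that Q max' by blast
qed

section \<open>Integral elements modulo an ideal, and lying over\<close>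

lemma (in cring) ideal_nat_pow_diff:
  assumes "ideal I R" "x \<in> carrier R" "y \<in> carrier R" "x \<ominus> y \<in> I"
  shows "x [^] (n::nat) \<ominus> y [^] n \<in> I"
proof (induction n)
  case 0
  show ?case
    using additive_subgroup.zero_closed[OF ideal.axioms(1)[OF assms(1)]]
    by (simp add: a_minus_def r_neg)
next
  case (Suc n)
  interpret I: ideal I R by fact
  have c: "x [^] n \<in> carrier R" "y [^] n \<in> carrier R" using assms by auto
  then have "x [^] Suc n \<ominus> y [^] Suc n = x \<otimes> (x [^] n \<ominus> y [^] n) \<oplus> y [^] n \<otimes> (x \<ominus> y)"
    using assms(2,3) unfolding nat_pow_Suc by algebra
  then show ?case
    using Suc assms c by (auto intro!: I.a_closed I.I_l_closed)
qed

text \<open>Modulo \<open>N\<close> the product \<open>a s\<close> is \<open>c\<close>. Multiplying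
  a monic equation of \<open>s\<close> by the power of \<open>a\<close> of the same degree turns the
  leading term into a power of \<open>c\<close>, while every other term keeps a spare factor
  \<open>a\<close>. With \<open>c\<close> outside a prime this gives lying over; with
  \<open>c = \<one>\<close> it inverts \<open>a\<close> inside \<open>C\<close>.\<close>

lemma (in cring) integral_relation:
  assumes C: "subring C R" and N: "ideal N R" and int: "integral_extension C R"
    and aC: "a \<in> C" and cC: "c \<in> C" and s: "s \<in> carrier R" and asc: "a \<otimes> s \<ominus> c \<in> N"
  shows "\<exists>n::nat. \<exists>r \<in> C. c [^] n \<oplus> a \<otimes> r \<in> N"
proof -
  interpret N: ideal N R by fact
  note Ccar = subsetD[OF subringE(1)[OF C]]
  note CE = subringE(2-7)[OF C]
  have ac: "a \<in> carrier R" "c \<in> carrier R" using aC cC Ccar by auto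
  have pow: "x [^] (n::nat) \<in> C" if "x \<in> C" for x n
    using that CE by (induction n) auto
  \<comment> \<open>A list of length at most \<open>n\<close> is a polynomial of degree below
    \<open>n\<close>, so each of its terms has a factor \<open>a\<close> to spare after the powers
    of \<open>s\<close> are absorbed into powers of \<open>a \<otimes> s\<close>, that is of
    \<open>c\<close> modulo \<open>N\<close>.\<close>
  have red: "\<exists>r \<in> C. a [^] n \<otimes> eval cs s \<ominus> a \<otimes> r \<in> N"
    if "set cs \<subseteq> C" "length cs \<le> n" for cs and n :: nat
    using that
  proof (induction cs)
    case Nil
    have "a [^] n \<otimes> \<zero> \<ominus> a \<otimes> \<zero> = \<zero>" using ac by (simp add: a_minus_def)
    then show ?case using CE N.zero_closed by (intro bexI[of _ \<zero>]) auto
  next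
    case (Cons d p)
    then obtain r where r: "r \<in> C" "a [^] n \<otimes> eval p s \<ominus> a \<otimes> r \<in> N" by auto
    let ?l = "length p"
    obtain k where k: "n = Suc (k + ?l)"
      using Cons.prems(2) by (metis add.commute add_Suc_right le_iff_add length_Cons)
    have d: "d \<in> C" using Cons.prems by simp
    have ev: "eval p s \<in> carrier R" using eval_in_carrier Cons.prems Ccar s by auto
    have car: "d \<in> carrier R" "r \<in> carrier R" "a [^] k \<in> carrier R" "a [^] ?l \<in> carrier R"
        "s [^] ?l \<in> carrier R" "c [^] ?l \<in> carrier R" "(a \<otimes> s) [^] ?l \<in> carrier R"
      using d r Ccar ac s by auto
    have ev': "eval (d # p) s = d \<otimes> s [^] ?l \<oplus> eval p s" by simp
    have an: "a [^] n = a \<otimes> (a [^] k \<otimes> a [^] ?l)"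
      using ac by (simp add: k nat_pow_mult m_comm)
    have as: "(a \<otimes> s) [^] ?l = a [^] ?l \<otimes> s [^] ?l"
      using ac s by (simp add: nat_pow_distrib)
    have diff: "(a \<otimes> s) [^] ?l \<ominus> c [^] ?l \<in> N"
      using ideal_nat_pow_diff[OF N.ideal_axioms _ _ asc] ac s by auto
    have "a [^] n \<otimes> eval (d # p) s \<ominus> a \<otimes> (r \<oplus> d \<otimes> a [^] k \<otimes> c [^] ?l)
      = (a [^] n \<otimes> eval p s \<ominus> a \<otimes> r) \<oplus> (d \<otimes> a \<otimes> a [^] k) \<otimes> ((a \<otimes> s) [^] ?l \<ominus> c [^] ?l)"
      unfolding as an ev' using car ac(1) ev by algebra
    also have "\<dots> \<in> N"
      using r diff car ac by (intro N.a_closed N.I_l_closed) auto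
    finally show ?case
      using CE d r pow aC cC by (intro bexI[of _ "r \<oplus> d \<otimes> a [^] k \<otimes> c [^] ?l"]) auto
  qed
  obtain cs where cs: "set cs \<subseteq> C" "eval (\<one> # cs) s = \<zero>"
    using int s unfolding integral_extension_def by blast
  let ?n = "length cs"
  obtain r where r: "r \<in> C" "a [^] ?n \<otimes> eval cs s \<ominus> a \<otimes> r \<in> N" using red[OF cs(1)] by blast
  have ev: "eval cs s \<in> carrier R" using eval_in_carrier cs Ccar s by auto
  have car: "r \<in> carrier R" "a [^] ?n \<in> carrier R" "s [^] ?n \<in> carrier R"
      "c [^] ?n \<in> carrier R" "(a \<otimes> s) [^] ?n \<in> carrier R"
    using r Ccar ac s by auto
  have as: "(a \<otimes> s) [^] ?n = a [^] ?n \<otimes> s [^] ?n"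
    using ac s by (simp add: nat_pow_distrib)
  have "s [^] ?n \<oplus> eval cs s = \<zero>" using cs(2) car by simp
  then have "a [^] ?n \<otimes> s [^] ?n \<oplus> a [^] ?n \<otimes> eval cs s = \<zero>"
    using car ev by (metis r_distr r_null)
  then have "c [^] ?n \<oplus> a \<otimes> r
      = c [^] ?n \<oplus> a \<otimes> r \<ominus> (a [^] ?n \<otimes> s [^] ?n \<oplus> a [^] ?n \<otimes> eval cs s)"
    using car ac by (simp add: a_minus_def)
  also have "\<dots> = (\<ominus> \<one>) \<otimes> (((a \<otimes> s) [^] ?n \<ominus> c [^] ?n)
      \<oplus> (a [^] ?n \<otimes> eval cs s \<ominus> a \<otimes> r))"
    unfolding as using car ev ac(1) by algebra
  also have "\<dots> \<in> N"
    using ideal_nat_pow_diff[OF N.ideal_axioms _ _ asc] r ac s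
    by (intro N.I_l_closed N.a_closed) auto
  finally show ?thesis using r by blast
qed

text \<open>
  The prime upstairs is an ideal maximal among those meeting the subring inside \<open>Q\<close>. It contains
  \<open>Q\<close>: otherwise some \<open>c\<close> in the subring but not in \<open>Q\<close> is congruent to \<open>s \<otimes> a\<close> with \<open>a \<in> Q\<close>,
  and multiplying a monic equation of \<open>s\<close> by a power of \<open>a\<close> shows that a power of \<open>c\<close> lies in \<open>Q\<close>.
\<close>

lemma (in cring) lying_over:
  assumes C: "subring C R" and int: "integral_extension C R"
    and Q: "primeideal Q (R\<lparr>carrier := C\<rparr>)"
  obtains N where "primeideal N R" "N \<inter> C = Q"
proof -
  interpret Q: primeideal Q "R\<lparr>carrier := C\<rparr>" by fact
  note Ccar = subsetD[OF subringE(1)[OF C]]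
  note CE = subringE(2-7)[OF C]
  have QC: "Q \<subseteq> C" using Q.a_subset by simp
  have Qzero: "\<zero> \<in> Q"
    using additive_subgroup.zero_closed[OF Q.additive_subgroup_axioms] by simp
  have "\<one> \<notin> Q" using Q.one_imp_carrier Q.I_notcarr by auto
  have prime: "a \<in> Q \<or> b \<in> Q" if "a \<in> C" "b \<in> C" "a \<otimes> b \<in> Q" for a b
    using Q.I_prime that by simp
  obtain N where N: "primeideal N R" "N \<inter> (C - Q) = {}"
    and max: "\<And>J. ideal J R \<Longrightarrow> N \<subset> J \<Longrightarrow> J \<inter> (C - Q) \<noteq> {}"
  proof (rule exists_primeideal_avoiding[OF zeroideal, of "C - Q"])
    show "C - Q \<subseteq> carrier R" using Ccar by blast
    show "\<one> \<in> C - Q" using CE \<open>\<one> \<notin> Q\<close> by blast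
    show "\<And>x y. x \<in> C - Q \<Longrightarrow> y \<in> C - Q \<Longrightarrow> x \<otimes> y \<in> C - Q" using CE(5) prime by auto
    show "{\<zero>} \<inter> (C - Q) = {}" using Qzero by auto
  qed blast
  interpret N: primeideal N R by fact
  have "a \<in> N" if a: "a \<in> Q" for a
  proof (rule ccontr)
    assume "a \<notin> N"
    have aC: "a \<in> C" "a \<in> carrier R" using a QC Ccar by auto
    obtain q s where qs: "q \<in> N" "s \<in> carrier R" "q \<oplus> s \<otimes> a \<in> C - Q"
      using max[OF ideal_adjoin(1)[OF N.ideal_axioms aC(2)]]
        ideal_adjoin(2,3)[OF N.ideal_axioms aC(2)] \<open>a \<notin> N\<close>
      by blast
    define c where "c = q \<oplus> s \<otimes> a"
    have c: "c \<in> C" "c \<notin> Q" "c \<in> carrier R" using qs(3) Ccar unfolding c_def by auto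
    have "q \<in> carrier R" using qs N.a_Hcarr by blast
    then have "a \<otimes> s \<ominus> c = \<ominus> q"
      unfolding c_def using qs aC by algebra
    then have asc: "a \<otimes> s \<ominus> c \<in> N" using qs N.a_inv_closed by simp
    have pow: "x [^] (n::nat) \<in> C" if "x \<in> C" for x n
      using that CE by (induction n) auto
    obtain n r where r: "r \<in> C" "c [^] (n::nat) \<oplus> a \<otimes> r \<in> N"
      using integral_relation[OF C N.ideal_axioms int aC(1) c(1) qs(2) asc] by blast
    then have "c [^] n \<oplus> a \<otimes> r \<in> Q"
      using N(2) CE(5)[OF aC(1) r(1)] CE(6)[OF pow[OF c(1)]] by blast
    moreover have "a \<otimes> r \<in> Q" using Q.I_r_closed[OF a] r by simp
    ultimately have "(c [^] n \<oplus> a \<otimes> r) \<ominus>\<^bsub>R\<lparr>carrier := C\<rparr>\<^esub> (a \<otimes> r) \<in> Q"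
      using additive_subgroup.a_closed[OF Q.additive_subgroup_axioms]
        additive_subgroup.a_inv_closed[OF Q.additive_subgroup_axioms]
      unfolding a_minus_def by simp
    then have "(c [^] n \<oplus> a \<otimes> r) \<ominus> (a \<otimes> r) \<in> Q"
      using subring_minus_consistent[OF C] CE pow c aC r by simp
    moreover have "(c [^] n \<oplus> a \<otimes> r) \<ominus> (a \<otimes> r) = c [^] n"
    proof -
      have "c [^] n \<in> carrier R" "r \<in> carrier R" using c r Ccar by auto
      then show ?thesis using aC(2) by algebra
    qed
    ultimately have "c [^] n \<in> Q" by simp
    moreover have "c [^] m \<notin> Q" for m :: nat
      by (induction m) (use \<open>\<one> \<notin> Q\<close> prime pow c in auto)
    ultimately show False by blast
  qed
  then have "N \<inter> C = Q" using N(2) QC by blast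
  then show ?thesis using that N by blast
qed

section \<open>Minimal extensions\<close>

text \<open>For a subring \<open>B\<close> this is the largest ideal of \<open>S\<close> contained
  in it. For a step \<open>B \<subset> C\<close> the relevant conductor is the one taken with
  \<open>C\<close> as the ambient ring.\<close>

definition conductor :: "'a set \<Rightarrow> ('a, 'b) ring_scheme \<Rightarrow> 'a set" where
  "conductor B S = {a \<in> carrier S. \<forall>r \<in> carrier S. a \<otimes>\<^bsub>S\<^esub> r \<in> B}"

lemma (in cring) conductor_ideal:
  assumes "subring B R" shows "ideal (conductor B R) R"
proof (rule ideal_memI)
  show "conductor B R \<subseteq> carrier R" unfolding conductor_def by blast
  show "\<zero> \<in> conductor B R" unfolding conductor_def using subringE(2)[OF assms] by simp
  show "a \<oplus> b \<in> conductor B R" if "a \<in> conductor B R" "b \<in> conductor B R" for a b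
    using that subringE(7)[OF assms] unfolding conductor_def by (simp add: l_distr)
  show "r \<otimes> a \<in> conductor B R" if "a \<in> conductor B R" "r \<in> carrier R" for a r
  proof -
    have "r \<otimes> a \<otimes> t = a \<otimes> (r \<otimes> t)" if "t \<in> carrier R" for t
      using \<open>a \<in> _\<close> \<open>r \<in> _\<close> that unfolding conductor_def by (simp add: m_ac)
    then show ?thesis using that unfolding conductor_def by simp
  qed
qed

lemma (in cring) conductor_subset: "conductor B R \<subseteq> B"
proof
  fix a assume "a \<in> conductor B R"
  then have "a \<in> carrier R" "a \<otimes> \<one> \<in> B" unfolding conductor_def by blast+
  then show "a \<in> B" by simp
qed

lemma (in cring) subring_add_ideal:
  assumes B: "subring B R" and J: "ideal J R"
  shows "subring {b \<oplus> j | b j. b \<in> B \<and> j \<in> J} R"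
proof -
  interpret J: ideal J R by fact
  note BE = subringE[OF B]
  let ?W = "{b \<oplus> j | b j. b \<in> B \<and> j \<in> J}"
  show ?thesis
  proof (rule subringI)
    show "?W \<subseteq> carrier R" using BE(1) J.Icarr by blast
    have "\<one> = \<one> \<oplus> \<zero>" by simp
    then show "\<one> \<in> ?W" using BE(3) J.zero_closed by blast
    fix x assume "x \<in> ?W"
    then obtain b j where x: "x = b \<oplus> j" "b \<in> B" "j \<in> J" by blast
    have cx: "b \<in> carrier R" "j \<in> carrier R" using x BE(1) J.Icarr by auto
    have "\<ominus> x = \<ominus> b \<oplus> \<ominus> j" unfolding x using cx by algebra
    then show "\<ominus> x \<in> ?W" using BE(5) J.a_inv_closed x by blast
    fix y assume "y \<in> ?W"
    then obtain c k where y: "y = c \<oplus> k" "c \<in> B" "k \<in> J" by blast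
    have cy: "c \<in> carrier R" "k \<in> carrier R" using y BE(1) J.Icarr by auto
    have "x \<oplus> y = (b \<oplus> c) \<oplus> (j \<oplus> k)" unfolding x y using cx cy by algebra
    then show "x \<oplus> y \<in> ?W" using BE(7)[OF x(2) y(2)] J.a_closed[OF x(3) y(3)] by blast
    have "x \<otimes> y = b \<otimes> c \<oplus> (b \<otimes> k \<oplus> (c \<oplus> k) \<otimes> j)"
      unfolding x y using cx cy by algebra
    moreover have "b \<otimes> k \<oplus> (c \<oplus> k) \<otimes> j \<in> J"
      using cx cy x y by (intro J.a_closed J.I_l_closed) auto
    ultimately show "x \<otimes> y \<in> ?W" using BE(6)[OF x(2) y(2)] by blast
  qed
qed

text \<open>Products keep the form \<open>f + g x\<close> because \<open>x \<otimes> x\<close> is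
  congruent to zero or to \<open>x\<close> modulo \<open>I\<close>. The coefficients of
  \<open>x\<close> form a separate \<open>F\<close>-module \<open>G\<close>, since the later rings
  \<open>B + Bx\<close>, \<open>B + aBx\<close>, \<open>F + Bx\<close> and \<open>V' + V'x\<close>
  need different choices of it.\<close>

lemma (in cring) subring_adjoin:
  assumes F: "subring F R" and I: "ideal I R" "I \<subseteq> F"
    and G: "G \<subseteq> carrier R" "\<zero> \<in> G" "\<And>a b. a \<in> G \<Longrightarrow> b \<in> G \<Longrightarrow> a \<oplus> b \<in> G"
      "\<And>a b. a \<in> G \<Longrightarrow> b \<in> G \<Longrightarrow> a \<otimes> b \<in> G" "\<And>a b. a \<in> F \<Longrightarrow> b \<in> G \<Longrightarrow> a \<otimes> b \<in> G"
    and x: "x \<in> carrier R" "x \<otimes> x \<in> I \<or> x \<otimes> x \<ominus> x \<in> I"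
  shows "subring {f \<oplus> g \<otimes> x | f g. f \<in> F \<and> g \<in> G} R"
proof -
  interpret I: ideal I R by fact
  note FE = subringE[OF F]
  let ?W = "{f \<oplus> g \<otimes> x | f g. f \<in> F \<and> g \<in> G}"
  show ?thesis
  proof (rule subringI)
    show "?W \<subseteq> carrier R" using FE(1) G(1) x(1) by auto
    have "\<one> = \<one> \<oplus> \<zero> \<otimes> x" using x(1) by simp
    then show "\<one> \<in> ?W" using FE(3) G(2) by blast
    fix y assume "y \<in> ?W"
    then obtain f g where y: "y = f \<oplus> g \<otimes> x" "f \<in> F" "g \<in> G" by blast
    have cy: "f \<in> carrier R" "g \<in> carrier R" using y FE(1) G(1) by auto
    have "\<ominus> y = \<ominus> f \<oplus> ((\<ominus> \<one>) \<otimes> g) \<otimes> x" unfolding y using cy x(1) by algebra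
    then show "\<ominus> y \<in> ?W" using FE(5)[OF y(2)] G(5)[OF FE(5)[OF FE(3)] y(3)] by blast
    fix z assume "z \<in> ?W"
    then obtain h k where z: "z = h \<oplus> k \<otimes> x" "h \<in> F" "k \<in> G" by blast
    have cz: "h \<in> carrier R" "k \<in> carrier R" using z FE(1) G(1) by auto
    have "y \<oplus> z = (f \<oplus> h) \<oplus> (g \<oplus> k) \<otimes> x" unfolding y z using cy cz x(1) by algebra
    then show "y \<oplus> z \<in> ?W" using FE(7)[OF y(2) z(2)] G(3)[OF y(3) z(3)] by blast
    have fk: "f \<otimes> k \<oplus> h \<otimes> g \<in> G" using G(3,5) y z by auto
    show "y \<otimes> z \<in> ?W"
      using x(2)
    proof
      assume xx: "x \<otimes> x \<in> I"
      have "y \<otimes> z = (f \<otimes> h \<oplus> (g \<otimes> k) \<otimes> (x \<otimes> x)) \<oplus> (f \<otimes> k \<oplus> h \<otimes> g) \<otimes> x"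
        unfolding y z using cy cz x(1) by algebra
      moreover have "(g \<otimes> k) \<otimes> (x \<otimes> x) \<in> F"
        using I.I_l_closed[OF xx] cy cz I(2) by auto
      ultimately show ?thesis using fk FE(7)[OF FE(6)[OF y(2) z(2)]] by blast
    next
      assume xx: "x \<otimes> x \<ominus> x \<in> I"
      have "y \<otimes> z = (f \<otimes> h \<oplus> (g \<otimes> k) \<otimes> (x \<otimes> x \<ominus> x)) \<oplus> (f \<otimes> k \<oplus> h \<otimes> g \<oplus> g \<otimes> k) \<otimes> x"
        unfolding y z using cy cz x(1) by algebra
      moreover have "(g \<otimes> k) \<otimes> (x \<otimes> x \<ominus> x) \<in> F"
        using I.I_l_closed[OF xx] cy cz I(2) by auto
      moreover have "f \<otimes> k \<oplus> h \<otimes> g \<oplus> g \<otimes> k \<in> G"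
        using fk G(3,4) y z by auto
      ultimately show ?thesis using FE(7)[OF FE(6)[OF y(2) z(2)]] by blast
    qed
  qed
qed

text \<open>\<open>R\<close> is the upper ring of a step with nothing strictly between; a step
  inside a larger ring is treated by interpreting the locale with its upper ring as ambient
  ring.\<close>

locale minimal_extension = cring +
  fixes B :: "'a set"
  assumes subring: "subring B R"
    and proper: "B \<noteq> carrier R"
    and minimal: "\<And>W. subring W R \<Longrightarrow> B \<subseteq> W \<Longrightarrow> W = B \<or> W = carrier R"
begin

abbreviation I :: "'a set" where "I \<equiv> conductor B R"

sublocale I: ideal I R by (rule conductor_ideal[OF subring])

lemmas BE = subringE[OF subring]

lemma B_carrier: "b \<in> B \<Longrightarrow> b \<in> carrier R"
  using BE(1) by blast

lemma I_subset: "I \<subseteq> B"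
  by (rule conductor_subset)

lemma B_minus: "a \<in> B \<Longrightarrow> b \<in> B \<Longrightarrow> a \<ominus> b \<in> B"
  by (rule subring_minus_closed[OF subring])

lemma one_notin_I: "\<one> \<notin> I"
proof
  assume "\<one> \<in> I"
  then have "carrier R \<subseteq> B" using I.one_imp_carrier I_subset by blast
  then show False using proper BE(1) by blast
qed

lemma ideal_decomp:
  assumes J: "ideal J R" "\<not> J \<subseteq> B" and c: "c \<in> carrier R"
  obtains b j where "b \<in> B" "j \<in> J" "c = b \<oplus> j"
proof -
  interpret J: ideal J R by fact
  let ?W = "{b \<oplus> j | b j. b \<in> B \<and> j \<in> J}"
  have BW: "B \<subseteq> ?W"
  proof
    fix b assume b: "b \<in> B"
    then have "b = b \<oplus> \<zero>" using B_carrier by simp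
    then show "b \<in> ?W" using b J.zero_closed by blast
  qed
  have "J \<subseteq> ?W"
  proof
    fix j assume j: "j \<in> J"
    then have "j = \<zero> \<oplus> j" using J.Icarr by simp
    then show "j \<in> ?W" using j BE(2) by blast
  qed
  then have "?W = carrier R"
    using minimal[OF subring_add_ideal[OF subring J(1)] BW] J(2) by blast
  then show ?thesis using c that by blast
qed

lemma principal_decomp:
  assumes "a \<in> carrier R" "r \<in> carrier R" "r \<otimes> a \<notin> B" "c \<in> carrier R"
  obtains b t where "b \<in> B" "t \<in> carrier R" "c = b \<oplus> t \<otimes> a"
proof -
  have "\<not> PIdl a \<subseteq> B" using assms unfolding cgenideal_def by blast
  then obtain b j where "b \<in> B" "j \<in> PIdl a" "c = b \<oplus> j"
    using ideal_decomp[OF cgenideal_ideal[OF assms(1)] _ assms(4)] by blast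
  then show ?thesis using that unfolding cgenideal_def by blast
qed

text \<open>If \<open>a\<close> is not in the conductor, some multiple of \<open>a\<close> leaves
  \<open>B\<close>, so \<open>R = B + Ra\<close> by minimality. Multiplying by \<open>b\<close> puts
  \<open>bR\<close> inside \<open>B + Rab\<close>, and the last summand lies in
  \<open>I\<close>.\<close>

lemma I_prime:
  assumes "a \<in> B" "b \<in> B" "a \<otimes> b \<in> I" "a \<notin> I"
  shows "b \<in> I"
proof -
  have car: "a \<in> carrier R" "b \<in> carrier R" using assms B_carrier by auto
  obtain r0 where r0: "r0 \<in> carrier R" "r0 \<otimes> a \<notin> B"
    using assms(4) car unfolding conductor_def by (auto simp: m_comm)
  have "b \<otimes> r \<in> B" if r: "r \<in> carrier R" for r
  proof -
    obtain c t where ct: "c \<in> B" "t \<in> carrier R" "r = c \<oplus> t \<otimes> a"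
      using principal_decomp[OF car(1) r0 r] .
    have "c \<in> carrier R" using ct B_carrier by blast
    then have "b \<otimes> r = b \<otimes> c \<oplus> t \<otimes> (a \<otimes> b)"
      unfolding ct using ct(2) car by algebra
    moreover have "t \<otimes> (a \<otimes> b) \<in> B"
      using I.I_l_closed[OF assms(3) ct(2)] I_subset by blast
    ultimately show ?thesis using BE(6,7) assms ct by simp
  qed
  then show ?thesis using car unfolding conductor_def by blast
qed

lemma I_nat_pow:
  assumes "a \<in> B" "a [^] (n::nat) \<in> I"
  shows "a \<in> I"
proof -
  have pow: "a [^] (k::nat) \<in> B" for k
    by (induction k) (use assms(1) BE in auto)
  show ?thesis
    using assms(2)
  proof (induction n)
    case 0
    then show ?case using one_notin_I by simp
  next
    case (Suc n)
    then show ?case using I_prime[OF pow assms(1)] by auto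
  qed
qed

text \<open>Here \<open>Q = I\<close>, so residual triviality provides \<open>s\<close> outside
  \<open>I\<close> with \<open>s y\<close> in \<open>B\<close> for some \<open>y\<close> outside
  \<open>B\<close>. As \<open>y\<close> is integral, one power of \<open>s\<close> is a denominator
  for all powers of \<open>y\<close>, hence for the whole ring, which \<open>y\<close> generates
  over \<open>B\<close>. That power is in the conductor, and \<open>I_nat_pow\<close> puts
  \<open>s\<close> there.\<close>

lemma no_birational_prime:
  assumes int: "integral_extension B R" and Q: "ideal Q R" "Q \<subseteq> B" "Q \<inter> B = I"
    and res: "residually_trivial_at B R Q"
  shows False
proof -
  interpret Q: ideal Q R by fact
  obtain y where y: "y \<in> carrier R" "y \<notin> B" using proper BE(1) by blast
  obtain s b where s: "s \<in> B" "s \<notin> Q" "b \<in> B" "s \<otimes> y \<ominus> b \<in> Q"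
    using res y unfolding residually_trivial_at_def by blast
  have car: "s \<in> carrier R" "b \<in> carrier R" using s B_carrier by auto
  have "s \<notin> I" using s Q by blast
  have "s \<otimes> y = (s \<otimes> y \<ominus> b) \<oplus> b" using car y by algebra
  then have sy: "s \<otimes> y \<in> B" using s Q(2) BE(7)[of "s \<otimes> y \<ominus> b" b] by auto
  obtain cs where cs: "set cs \<subseteq> B" "eval (\<one> # cs) y = \<zero>"
    using int y unfolding integral_extension_def by blast
  define n where "n = length cs"
  define \<sigma> where "\<sigma> = s [^] n"
  have pow: "a [^] (k::nat) \<in> B" if "a \<in> B" for a k
    by (induction k) (use that BE in auto)
  have \<sigma>: "\<sigma> \<in> B" "\<sigma> \<in> carrier R" unfolding \<sigma>_def using pow s car by auto
  have ev: "eval ds y \<in> carrier R" if "set ds \<subseteq> B" for ds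
    using eval_in_carrier that B_carrier y by blast
  \<comment> \<open>Below the degree \<open>n\<close> the factor \<open>\<sigma>\<close> holds a
    copy of \<open>s\<close> for each \<open>y\<close>; from \<open>n\<close> on, the monic equation
    replaces \<open>y [^] n\<close> by lower powers, which the induction hypothesis covers.\<close>
  have powers: "\<sigma> \<otimes> y [^] m \<in> B" for m :: nat
  proof (induction m rule: less_induct)
    case (less m)
    show ?case
    proof (cases "m < n")
      case True
      then obtain k where k: "n = m + k" using less_imp_add_positive by blast
      have "\<sigma> \<otimes> y [^] m = s [^] k \<otimes> (s \<otimes> y) [^] m"
        unfolding \<sigma>_def k using car y by (simp add: nat_pow_mult[symmetric] nat_pow_distrib m_ac)
      then show ?thesis using pow[OF s(1)] pow[OF sy] BE(6) by simp
    next
      case False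
      then obtain k where k: "m = k + n" using le_Suc_ex[of n m] by (auto simp: add.commute)
      have red: "\<sigma> \<otimes> (y [^] k \<otimes> eval ds y) \<in> B" if "set ds \<subseteq> B" "length ds \<le> n" for ds
        using that
      proof (induction ds)
        case Nil
        then show ?case using \<sigma> y BE(2) by simp
      next
        case (Cons d ds)
        have d: "d \<in> B" "d \<in> carrier R" using Cons.prems B_carrier by auto
        let ?l = "length ds"
        have c: "y [^] k \<in> carrier R" "y [^] ?l \<in> carrier R" "eval ds y \<in> carrier R"
          using y ev Cons.prems by auto
        have e: "eval (d # ds) y = d \<otimes> y [^] ?l \<oplus> eval ds y" by simp
        have "\<sigma> \<otimes> (y [^] k \<otimes> eval (d # ds) y)
            = d \<otimes> (\<sigma> \<otimes> (y [^] k \<otimes> y [^] ?l)) \<oplus> \<sigma> \<otimes> (y [^] k \<otimes> eval ds y)"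
          unfolding e using c d \<sigma>(2) by algebra
        moreover have "\<sigma> \<otimes> (y [^] k \<otimes> y [^] ?l) \<in> B"
          using less.IH[of "k + ?l"] Cons.prems k y by (simp add: nat_pow_mult)
        ultimately show ?case using BE(6,7) d Cons by simp
      qed
      have c: "y [^] k \<in> carrier R" "y [^] n \<in> carrier R" "eval cs y \<in> carrier R"
        using y ev cs by auto
      have "y [^] n \<oplus> eval cs y = \<zero>" using cs(2) c unfolding n_def by simp
      then have yn: "y [^] n = \<ominus> eval cs y" using c by (simp add: minus_equality a_comm)
      have "\<sigma> \<otimes> y [^] m = \<sigma> \<otimes> (y [^] k \<otimes> y [^] n)"
        using k y by (simp add: nat_pow_mult)
      also have "\<dots> = \<ominus> (\<sigma> \<otimes> (y [^] k \<otimes> eval cs y))"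
        unfolding yn using c \<sigma>(2) by algebra
      finally show ?thesis using BE(5) red cs(1) n_def by simp
    qed
  qed
  \<comment> \<open>The multiplier ring of the module of all \<open>z\<close> with \<open>\<sigma> z y\<^sup>m \<in> B\<close> for every \<open>m\<close>: it contains
    \<open>B\<close> and \<open>y\<close>, hence is everything, so \<open>\<sigma>\<close> lies in the conductor.\<close>
  define P where "P = {c \<in> carrier R. \<forall>z \<in> carrier R.
    (\<forall>m::nat. \<sigma> \<otimes> (z \<otimes> y [^] m) \<in> B) \<longrightarrow> (\<forall>m::nat. \<sigma> \<otimes> ((c \<otimes> z) \<otimes> y [^] m) \<in> B)}"
  have PD: "\<sigma> \<otimes> ((c \<otimes> z) \<otimes> y [^] m) \<in> B"
    if "c \<in> P" "z \<in> carrier R" "\<And>m::nat. \<sigma> \<otimes> (z \<otimes> y [^] m) \<in> B" for c z and m :: nat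
    using that unfolding P_def by blast
  have PI: "c \<in> P" if "c \<in> carrier R"
    "\<And>z m. z \<in> carrier R \<Longrightarrow> (\<And>m::nat. \<sigma> \<otimes> (z \<otimes> y [^] m) \<in> B) \<Longrightarrow>
       \<sigma> \<otimes> ((c \<otimes> z) \<otimes> y [^] (m::nat)) \<in> B" for c
    using that unfolding P_def by blast
  have Pcar: "c \<in> carrier R" if "c \<in> P" for c using that unfolding P_def by blast
  have ym: "y [^] m \<in> carrier R" for m :: nat using y by simp
  have BP: "B \<subseteq> P"
  proof
    fix c assume c: "c \<in> B"
    show "c \<in> P"
    proof (rule PI)
      show cc: "c \<in> carrier R" using c B_carrier by blast
      fix z and m :: nat assume z: "z \<in> carrier R" "\<And>m::nat. \<sigma> \<otimes> (z \<otimes> y [^] m) \<in> B"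
      have "\<sigma> \<otimes> ((c \<otimes> z) \<otimes> y [^] m) = c \<otimes> (\<sigma> \<otimes> (z \<otimes> y [^] m))"
        using cc z(1) \<sigma>(2) ym by (simp add: m_ac)
      then show "\<sigma> \<otimes> ((c \<otimes> z) \<otimes> y [^] m) \<in> B" using BE(6)[OF c z(2)] by simp
    qed
  qed
  have "y \<in> P"
  proof (rule PI[OF y(1)])
    fix z and m :: nat assume z: "z \<in> carrier R" "\<And>m::nat. \<sigma> \<otimes> (z \<otimes> y [^] m) \<in> B"
    have "\<sigma> \<otimes> ((y \<otimes> z) \<otimes> y [^] m) = \<sigma> \<otimes> (z \<otimes> y [^] Suc m)"
      using z(1) \<sigma>(2) ym y by (simp add: m_ac)
    then show "\<sigma> \<otimes> ((y \<otimes> z) \<otimes> y [^] m) \<in> B" using z(2)[of "Suc m"] by simp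
  qed
  moreover have "subring P R"
  proof (rule subringI)
    show "P \<subseteq> carrier R" using Pcar by blast
    show "\<one> \<in> P" using BP BE(3) by blast
    show "\<ominus> c \<in> P" if c: "c \<in> P" for c
    proof (rule PI)
      show "\<ominus> c \<in> carrier R" using Pcar c by simp
      fix z and m :: nat assume z: "z \<in> carrier R" "\<And>m::nat. \<sigma> \<otimes> (z \<otimes> y [^] m) \<in> B"
      have "\<sigma> \<otimes> ((\<ominus> c \<otimes> z) \<otimes> y [^] m) = \<ominus> (\<sigma> \<otimes> ((c \<otimes> z) \<otimes> y [^] m))"
        using Pcar[OF c] z(1) \<sigma>(2) ym[of m] by algebra
      then show "\<sigma> \<otimes> ((\<ominus> c \<otimes> z) \<otimes> y [^] m) \<in> B" using BE(5) PD[OF c z] by simp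
    qed
    fix c d assume cd: "c \<in> P" "d \<in> P"
    show "c \<otimes> d \<in> P"
    proof (rule PI)
      show "c \<otimes> d \<in> carrier R" using Pcar cd by simp
      fix z and m :: nat assume z: "z \<in> carrier R" "\<And>m::nat. \<sigma> \<otimes> (z \<otimes> y [^] m) \<in> B"
      have "\<sigma> \<otimes> ((c \<otimes> (d \<otimes> z)) \<otimes> y [^] m) \<in> B"
        using PD[OF cd(1) _ PD[OF cd(2) z]] Pcar cd z(1) by simp
      then show "\<sigma> \<otimes> ((c \<otimes> d \<otimes> z) \<otimes> y [^] m) \<in> B"
        using Pcar cd z(1) by (simp add: m_assoc)
    qed
    show "c \<oplus> d \<in> P"
    proof (rule PI)
      show "c \<oplus> d \<in> carrier R" using Pcar cd by simp
      fix z and m :: nat assume z: "z \<in> carrier R" "\<And>m::nat. \<sigma> \<otimes> (z \<otimes> y [^] m) \<in> B"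
      have "\<sigma> \<otimes> (((c \<oplus> d) \<otimes> z) \<otimes> y [^] m)
          = \<sigma> \<otimes> ((c \<otimes> z) \<otimes> y [^] m) \<oplus> \<sigma> \<otimes> ((d \<otimes> z) \<otimes> y [^] m)"
        using Pcar[OF cd(1)] Pcar[OF cd(2)] z(1) \<sigma>(2) ym[of m] by algebra
      then show "\<sigma> \<otimes> (((c \<oplus> d) \<otimes> z) \<otimes> y [^] m) \<in> B"
        using BE(7) PD[OF cd(1) z] PD[OF cd(2) z] by simp
    qed
  qed
  ultimately have "P = carrier R" using minimal[OF _ BP] y(2) by blast
  then have "\<sigma> \<otimes> c \<in> B" if "c \<in> carrier R" for c
    using PD[of c \<one> 0] powers ym that by simp
  then have "\<sigma> \<in> I" using \<sigma> unfolding conductor_def by blast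
  then show False using I_nat_pow[OF s(1)] \<open>s \<notin> I\<close> unfolding \<sigma>_def by blast
qed

text \<open>Modulo \<open>I\<close> the two primes meet in zero and turn out to be comaximal, as in
  the Chinese remainder theorem: an \<open>e\<close> in \<open>Q1\<close> with
  \<open>e \<ominus> \<one>\<close> in \<open>Q2\<close> is idempotent modulo \<open>I\<close>. It
  is outside \<open>B\<close> since both primes have the same trace there.\<close>

lemma idempotent_of_two_primes:
  assumes Q1: "primeideal Q1 R" "Q1 \<inter> B = I" "\<not> Q1 \<subseteq> B"
    and Q2: "primeideal Q2 R" "Q2 \<inter> B = I" "\<not> Q2 \<subseteq> B" and ne: "Q1 \<noteq> Q2"
  shows "\<exists>e \<in> carrier R - B. e \<otimes> e \<ominus> e \<in> I"
proof -
  interpret Q1: primeideal Q1 R by fact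
  interpret Q2: primeideal Q2 R by fact
  have J: "ideal (Q1 \<inter> Q2) R" using i_intersect[OF Q1.ideal_axioms Q2.ideal_axioms] .
  have "Q1 \<inter> Q2 \<subseteq> B"
  proof (rule ccontr)
    assume nJ: "\<not> Q1 \<inter> Q2 \<subseteq> B"
    \<comment> \<open>Every \<open>q\<close> is now \<open>b \<oplus> j\<close> with
      \<open>j\<close> in both primes, so membership in either of them amounts to
      \<open>b \<in> I\<close>, and the two primes would coincide.\<close>
    have "q \<in> Q1 \<longleftrightarrow> q \<in> Q2" if "q \<in> carrier R" for q
    proof -
      obtain b j where bj: "b \<in> B" "j \<in> Q1 \<inter> Q2" "q = b \<oplus> j"
        using ideal_decomp[OF J nJ \<open>q \<in> carrier R\<close>] .
      have c: "b \<in> carrier R" "j \<in> carrier R" using bj B_carrier Q1.Icarr by auto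
      have "b = q \<ominus> j" unfolding bj(3) using c by algebra
      then have "b \<in> Q" if "q \<in> Q" "j \<in> Q" "ideal Q R" for Q
        using that additive_subgroup.a_closed additive_subgroup.a_inv_closed ideal.axioms(1)
        unfolding a_minus_def by metis
      then have "q \<in> Q1 \<Longrightarrow> b \<in> I" "q \<in> Q2 \<Longrightarrow> b \<in> I"
        using bj Q1(2) Q2(2) Q1.ideal_axioms Q2.ideal_axioms by auto
      then show ?thesis
        unfolding bj(3) using bj(2) Q1(2) Q2(2) Q1.a_closed Q2.a_closed by blast
    qed
    then show False using ne Q1.Icarr Q2.Icarr by blast
  qed
  then have JI: "Q1 \<inter> Q2 \<subseteq> I" using Q1(2) by blast
  obtain a where a: "a \<in> Q1" "a \<notin> Q2" using Q1(3) JI I_subset by blast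
  have ac: "a \<in> carrier R" using a Q1.Icarr by blast
  obtain \<alpha> q where \<alpha>: "\<alpha> \<in> B" "q \<in> Q2" "a = \<alpha> \<oplus> q"
    using ideal_decomp[OF Q2.ideal_axioms Q2(3) ac] .
  have c: "\<alpha> \<in> carrier R" "q \<in> carrier R" using \<alpha> B_carrier Q2.Icarr by auto
  have "\<alpha> \<notin> Q2" using a \<alpha> Q2.a_closed by blast
  have "a \<otimes> \<alpha> \<notin> B"
  proof
    assume "a \<otimes> \<alpha> \<in> B"
    then have "a \<otimes> \<alpha> \<in> Q2" using Q1.I_r_closed[OF a(1) c(1)] Q1(2) Q2(2) by blast
    then show False using Q2.I_prime[OF ac c(1)] a \<open>\<alpha> \<notin> Q2\<close> by blast
  qed
  \<comment> \<open>The element \<open>t\<close> inverts \<open>\<alpha>\<close> modulo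
    \<open>Q2\<close>: \<open>b\<close> is a multiple of \<open>a\<close>, hence in
    \<open>Q1\<close>, in \<open>I\<close> and in \<open>Q2\<close>, while
    \<open>b = a (1 - t \<alpha>)\<close> with \<open>a\<close> outside \<open>Q2\<close>. So
    \<open>e = a t\<close> will be congruent to one modulo \<open>Q2\<close>.\<close>
  then obtain b t where bt: "b \<in> B" "t \<in> carrier R" "a = b \<oplus> t \<otimes> (a \<otimes> \<alpha>)"
    using principal_decomp[of "a \<otimes> \<alpha>" \<one> a] ac c by auto
  have bc: "b \<in> carrier R" using bt B_carrier by blast
  have "b = (b \<oplus> t \<otimes> (a \<otimes> \<alpha>)) \<ominus> (t \<otimes> \<alpha>) \<otimes> a" using bc bt(2) ac c by algebra
  also have "\<dots> = a \<ominus> (t \<otimes> \<alpha>) \<otimes> a" using bt(3) by simp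
  finally have b: "b = a \<ominus> (t \<otimes> \<alpha>) \<otimes> a" .
  then have "b \<in> Q1"
    using a(1) Q1.I_l_closed[OF a(1), of "t \<otimes> \<alpha>"] bt(2) c Q1.a_closed Q1.a_inv_closed
    unfolding a_minus_def by auto
  then have "b \<in> Q2" using bt Q1(2) Q2(2) by blast
  moreover have "b = a \<otimes> (\<one> \<ominus> t \<otimes> \<alpha>)" unfolding b using bt(2) ac c by algebra
  ultimately have \<alpha>t: "\<one> \<ominus> t \<otimes> \<alpha> \<in> Q2"
    using Q2.I_prime[OF ac, of "\<one> \<ominus> t \<otimes> \<alpha>"] a bt c by auto
  define e where "e = a \<otimes> t"
  have ec: "e \<in> carrier R" "e \<in> Q1" unfolding e_def using ac bt Q1.I_r_closed a by auto
  have "e \<ominus> \<one> = t \<otimes> q \<oplus> \<ominus> (\<one> \<ominus> t \<otimes> \<alpha>)"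
    unfolding e_def \<alpha>(3) using c bt(2) by algebra
  then have e1: "e \<ominus> \<one> \<in> Q2"
    using \<alpha>t Q2.I_l_closed[OF \<alpha>(2) bt(2)] Q2.a_closed Q2.a_inv_closed by simp
  have "e \<otimes> e \<ominus> e = e \<otimes> (e \<ominus> \<one>)" using ec(1) by algebra
  then have "e \<otimes> e \<ominus> e \<in> I"
    using JI Q1.I_r_closed[OF ec(2)] Q2.I_l_closed[OF e1] ec by auto
  moreover have "e \<notin> B"
  proof
    assume "e \<in> B"
    then have "e \<in> Q2" using ec Q1(2) Q2(2) by blast
    moreover have "\<one> = e \<oplus> \<ominus> (e \<ominus> \<one>)" using ec(1) by algebra
    ultimately have "\<one> \<in> Q2" using e1 Q2.a_closed Q2.a_inv_closed by metis
    then show False using Q2.one_imp_carrier Q2.I_notcarr by blast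
  qed
  ultimately show ?thesis using ec by blast
qed

text \<open>As \<open>Q\<close> is the only prime over \<open>I\<close>, its elements become
  nilpotent modulo \<open>I\<close> after localization at \<open>B - I\<close>. This yields a
  \<open>w\<close> in \<open>Q\<close> outside \<open>B\<close> with a power in \<open>I\<close>,
  and the last power of \<open>w\<close> before that is the required \<open>x\<close>.\<close>

lemma nilpotent_of_unique_prime:
  assumes Q: "primeideal Q R" "Q \<inter> B = I" "\<not> Q \<subseteq> B"
    and unique: "\<And>Q'. primeideal Q' R \<Longrightarrow> Q' \<inter> B = I \<Longrightarrow> Q' = Q"
  shows "\<exists>x \<in> carrier R - B. x \<otimes> x \<in> I"
proof -
  interpret Q: primeideal Q R by fact
  obtain q where q: "q \<in> Q" "q \<notin> B" using Q(3) by blast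
  have qc: "q \<in> carrier R" using q Q.Icarr by blast
  \<comment> \<open>If this multiplicative set generated by \<open>B - I\<close> and
    \<open>q\<close> missed \<open>I\<close>, a prime avoiding it would lie over \<open>I\<close>
    without containing \<open>q\<close>, against uniqueness.\<close>
  let ?W = "{s \<otimes> q [^] (n::nat) | s n. s \<in> B - I}"
  have "I \<inter> ?W \<noteq> {}"
  proof
    assume disj: "I \<inter> ?W = {}"
    have one: "\<one> \<in> B - I" using BE(3) one_notin_I by blast
    obtain Q' where Q': "primeideal Q' R" "I \<subseteq> Q'" "Q' \<inter> ?W = {}"
    proof (rule exists_primeideal_avoiding[OF I.ideal_axioms _ _ _ disj])
      show "?W \<subseteq> carrier R" using B_carrier qc by auto
      have "\<one> = \<one> \<otimes> q [^] (0::nat)" by simp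
      then show "\<one> \<in> ?W" using one by blast
      fix u v assume "u \<in> ?W" "v \<in> ?W"
      then obtain s m t n where *: "s \<in> B - I" "t \<in> B - I"
          "u = s \<otimes> q [^] (m::nat)" "v = t \<otimes> q [^] (n::nat)" by blast
      have "u \<otimes> v = (s \<otimes> t) \<otimes> q [^] (m + n)"
        unfolding * using * B_carrier qc by (simp add: nat_pow_mult[symmetric] m_ac)
      moreover have "s \<otimes> t \<in> B - I" using * I_prime BE(6) by blast
      ultimately show "u \<otimes> v \<in> ?W" by blast
    qed blast
    have "Q' \<inter> B \<subseteq> I"
    proof
      fix s assume s: "s \<in> Q' \<inter> B"
      have "s = s \<otimes> q [^] (0::nat)" using s B_carrier by simp
      then show "s \<in> I" using s Q'(3) by blast
    qed
    then have "Q' \<inter> B = I" using Q'(2) I_subset by blast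
    then have "q \<in> Q'" using unique Q' q by blast
    moreover have "q = \<one> \<otimes> q [^] (1::nat)" using qc by simp
    ultimately show False using Q'(3) one by blast
  qed
  then obtain s n where s: "s \<in> B" "s \<notin> I" "s \<otimes> q [^] (n::nat) \<in> I" by blast
  have sc: "s \<in> carrier R" using s B_carrier by blast
  define w where "w = s \<otimes> q"
  have w: "w \<in> carrier R" "w \<in> Q" unfolding w_def using sc qc Q.I_l_closed q by auto
  \<comment> \<open>Otherwise \<open>w = s q\<close> lies in \<open>I\<close>. Since
    \<open>Q\<close> is inside \<open>B + Rq\<close> and \<open>R = B + Q\<close>, multiplication by
    \<open>s\<close> would send \<open>Q\<close> and then all of \<open>R\<close> into
    \<open>B\<close>, making \<open>s\<close> an element of \<open>I\<close>.\<close>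
  have wB: "w \<notin> B"
  proof
    assume "w \<in> B"
    then have wI: "w \<in> I" using w Q(2) by blast
    have sQ: "s \<otimes> z \<in> B" if z: "z \<in> Q" for z
    proof -
      have zc: "z \<in> carrier R" using z Q.Icarr by blast
      obtain b t where bt: "b \<in> B" "t \<in> carrier R" "z = b \<oplus> t \<otimes> q"
        using principal_decomp[of q \<one> z] qc q zc by auto
      have bc: "b \<in> carrier R" using bt B_carrier by blast
      have "s \<otimes> z = s \<otimes> b \<oplus> t \<otimes> w" unfolding w_def bt(3) using bc bt(2) sc qc by algebra
      moreover have "t \<otimes> w \<in> B" using I.I_l_closed[OF wI bt(2)] I_subset by blast
      ultimately show ?thesis using BE(6,7) s bt by simp
    qed
    have "s \<otimes> r \<in> B" if r: "r \<in> carrier R" for r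
    proof -
      obtain b j where bj: "b \<in> B" "j \<in> Q" "r = b \<oplus> j"
        using ideal_decomp[OF Q.ideal_axioms Q(3) r] .
      have "s \<otimes> r = s \<otimes> b \<oplus> s \<otimes> j"
        unfolding bj(3) using bj B_carrier Q.Icarr sc by (simp add: r_distr)
      then show ?thesis using BE(6,7) s bj sQ by simp
    qed
    then show False using s sc unfolding conductor_def by blast
  qed
  have "n \<noteq> 0" using s sc by (intro notI) simp
  then obtain k where "n = Suc k" using not0_implies_Suc by blast
  then have "w [^] n = s [^] k \<otimes> (s \<otimes> q [^] n)"
    unfolding w_def using sc qc by (simp add: nat_pow_distrib m_ac)
  then have wn: "w [^] n \<in> I" using I.I_l_closed[OF s(3)] sc by simp
  \<comment> \<open>The least exponent \<open>l\<close> is at least two, because neither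
    \<open>\<one>\<close> nor \<open>w\<close> is in \<open>I\<close>. Hence \<open>2l - 2\<close>,
    the exponent of \<open>x \<otimes> x\<close>, is at least \<open>l\<close>.\<close>
  define l where "l = (LEAST l. w [^] (l::nat) \<in> I)"
  have l: "w [^] l \<in> I" "\<And>m. m < l \<Longrightarrow> w [^] m \<notin> I"
    unfolding l_def using LeastI[of "\<lambda>l. w [^] l \<in> I"] wn not_less_Least by auto
  have "l \<noteq> 0" using l(1) one_notin_I by (intro notI) simp
  moreover have "l \<noteq> 1" using l(1) wB I_subset w(1) by auto
  ultimately obtain m where m: "l = Suc (Suc m)" by (metis One_nat_def not0_implies_Suc)
  define x where "x = w [^] Suc m"
  have x: "x \<in> carrier R" unfolding x_def using w by simp
  have "x \<in> Q" unfolding x_def nat_pow_Suc using Q.I_l_closed[OF w(2)] w(1) by simp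
  moreover have "x \<notin> I" unfolding x_def by (rule l(2)) (simp add: m)
  ultimately have "x \<notin> B" using Q(2) by blast
  moreover have "x \<otimes> x = w [^] m \<otimes> w [^] l"
    unfolding x_def m using w(1) by (simp add: m_ac)
  then have "x \<otimes> x \<in> I" using I.I_l_closed[OF l(1)] w(1) by simp
  ultimately show ?thesis using x by blast
qed

text \<open>
  For a prime \<open>Q\<close> over the conductor \<open>I\<close>, minimality gives \<open>Q = I\<close> or \<open>B + Q = R\<close>. The former would
  make \<open>R/I\<close> birational over \<open>B/I\<close>. In the latter case, two such primes produce an idempotent modulo
  \<open>I\<close> (the decomposed case), a single one a nilpotent (the ramified case).
\<close>

lemma exists_generator:
  assumes int: "integral_extension B R"
    and res: "\<And>Q. primeideal Q R \<Longrightarrow> residually_trivial_at B R Q"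
  shows "\<exists>x \<in> carrier R - B. x \<otimes> x \<in> I \<or> x \<otimes> x \<ominus> x \<in> I"
proof -
  obtain Q where Q: "primeideal Q R" "I \<subseteq> Q" "Q \<inter> (B - I) = {}"
  proof (rule exists_primeideal_avoiding[OF I.ideal_axioms, of "B - I"])
    show "B - I \<subseteq> carrier R" using B_carrier by blast
    show "\<one> \<in> B - I" using BE(3) one_notin_I by blast
    show "\<And>x y. x \<in> B - I \<Longrightarrow> y \<in> B - I \<Longrightarrow> x \<otimes> y \<in> B - I" using BE(6) I_prime by auto
  qed blast+
  have QI: "Q \<inter> B = I" using Q I_subset by blast
  have nB: "\<not> Q' \<subseteq> B" if "primeideal Q' R" "Q' \<inter> B = I" for Q'
    using no_birational_prime[OF int primeideal.axioms(1)[OF that(1)] _ that(2) res[OF that(1)]]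
    by blast
  show ?thesis
  proof (cases "\<exists>Q'. primeideal Q' R \<and> Q' \<inter> B = I \<and> Q' \<noteq> Q")
    case True
    then show ?thesis using idempotent_of_two_primes Q(1) QI nB by metis
  next
    case False
    then show ?thesis using nilpotent_of_unique_prime Q(1) QI nB by metis
  qed
qed

section \<open>The decomposition \<open>R = B + Bx\<close> and the residue field
  \<open>B/I\<close>\<close>

context
  fixes x
  assumes x: "x \<in> carrier R" "x \<notin> B" and xx: "x \<otimes> x \<in> I \<or> x \<otimes> x \<ominus> x \<in> I"
begin

lemma generator_decomp:
  assumes "c \<in> carrier R"
  obtains b d where "b \<in> B" "d \<in> B" "c = b \<oplus> d \<otimes> x"
proof -
  let ?W = "{f \<oplus> g \<otimes> x | f g. f \<in> B \<and> g \<in> B}"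
  have W: "subring ?W R"
    by (rule subring_adjoin[OF subring I.ideal_axioms I_subset BE(1,2,7,6,6) x(1) xx])
  have BW: "B \<subseteq> ?W"
  proof
    fix b assume b: "b \<in> B"
    then have "b = b \<oplus> \<zero> \<otimes> x" using B_carrier x by simp
    then show "b \<in> ?W" using b BE(2) by blast
  qed
  have "x = \<zero> \<oplus> \<one> \<otimes> x" using x by simp
  then have "x \<in> ?W" using BE(2,3) by blast
  then have "?W = carrier R" using minimal[OF W BW] x by blast
  then show ?thesis using assms that by blast
qed

text \<open>Because \<open>R = B + Bx\<close>, multiplication by \<open>x\<close> alone tests
  membership in the conductor. In other words, multiplication by \<open>x\<close> identifies
  \<open>B/I\<close> with \<open>R/B\<close>.\<close>

lemma mult_generator_in_B:
  assumes "b \<in> B" "b \<otimes> x \<in> B"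
  shows "b \<in> I"
proof -
  have bc: "b \<in> carrier R" using assms B_carrier by blast
  have "b \<otimes> c \<in> B" if c: "c \<in> carrier R" for c
  proof -
    obtain f g where fg: "f \<in> B" "g \<in> B" "c = f \<oplus> g \<otimes> x" using generator_decomp[OF c] .
    have "f \<in> carrier R" "g \<in> carrier R" using fg B_carrier by auto
    then have "b \<otimes> c = b \<otimes> f \<oplus> g \<otimes> (b \<otimes> x)" unfolding fg(3) using bc x by algebra
    then show ?thesis using BE(6,7) assms fg by simp
  qed
  then show ?thesis using bc unfolding conductor_def by blast
qed

text \<open>For \<open>a\<close> outside \<open>I\<close> the ring \<open>B + aBx\<close> is
  strictly larger than \<open>B\<close>, hence contains \<open>x\<close>. Comparing coefficients of
  \<open>x\<close> puts \<open>(a b - 1) x\<close> in \<open>B\<close>, so \<open>a b - 1\<close> is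
  in \<open>I\<close>. Thus \<open>I\<close> is maximal in \<open>B\<close>.\<close>

lemma inverse_mod_I:
  assumes a: "a \<in> B" "a \<notin> I"
  obtains b where "b \<in> B" "a \<otimes> b \<ominus> \<one> \<in> I"
proof -
  have ac: "a \<in> carrier R" using a B_carrier by blast
  let ?G = "{a \<otimes> b | b. b \<in> B}"
  let ?W = "{f \<oplus> g \<otimes> x | f g. f \<in> B \<and> g \<in> ?G}"
  have W: "subring ?W R"
  proof (rule subring_adjoin[OF subring I.ideal_axioms I_subset _ _ _ _ _ x(1) xx])
    show "?G \<subseteq> carrier R" using ac B_carrier by auto
    show "\<zero> \<in> ?G" using ac BE(2) by force
    fix u v assume v: "v \<in> ?G"
    then obtain v' where v': "v' \<in> B" "v = a \<otimes> v'" by blast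
    show "u \<otimes> v \<in> ?G" if u: "u \<in> B"
    proof -
      have "u \<otimes> v = a \<otimes> (u \<otimes> v')" unfolding v' using u v' ac B_carrier by (simp add: m_ac)
      then show ?thesis using BE(6)[OF u v'(1)] by blast
    qed
    then show "u \<otimes> v \<in> ?G" if "u \<in> ?G" using that BE(6)[OF a(1)] by blast
    show "u \<oplus> v \<in> ?G" if "u \<in> ?G"
    proof -
      obtain u' where u': "u' \<in> B" "u = a \<otimes> u'" using \<open>u \<in> ?G\<close> by blast
      have "u \<oplus> v = a \<otimes> (u' \<oplus> v')" unfolding u' v' using u' v' ac B_carrier by (simp add: r_distr)
      then show ?thesis using BE(7)[OF u'(1) v'(1)] by blast
    qed
  qed
  have BW: "B \<subseteq> ?W"
  proof
    fix b assume b: "b \<in> B"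
    then have "b = b \<oplus> (a \<otimes> \<zero>) \<otimes> x" using B_carrier x ac by simp
    then show "b \<in> ?W" using b BE(2) by blast
  qed
  have "a \<otimes> x = \<zero> \<oplus> (a \<otimes> \<one>) \<otimes> x" using x ac by simp
  then have "a \<otimes> x \<in> ?W" using BE(2,3) by blast
  moreover have "a \<otimes> x \<notin> B" using mult_generator_in_B a by blast
  ultimately have "?W = carrier R" using minimal[OF W BW] by blast
  then have "x \<in> ?W" using x by blast
  then obtain f b where fb: "f \<in> B" "b \<in> B" "x = f \<oplus> a \<otimes> b \<otimes> x" by blast
  have c: "f \<in> carrier R" "b \<in> carrier R" using fb B_carrier by auto
  have "(a \<otimes> b \<ominus> \<one>) \<otimes> x = (f \<oplus> a \<otimes> b \<otimes> x) \<ominus> x \<ominus> f" using c ac x by algebra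
  also have "\<dots> = \<ominus> f" unfolding fb(3)[symmetric] using x c by algebra
  finally have "(a \<otimes> b \<ominus> \<one>) \<otimes> x \<in> B" using BE(5) fb by simp
  then show ?thesis
    using that fb(2) mult_generator_in_B B_minus[OF BE(6)[OF a(1) fb(2)] BE(3)] by blast
qed

end

end

section \<open>Restriction to subrings and the structure of covers\<close>

lemma (in cring) subring_subring:
  assumes C: "subring C R" and W: "subring W (R\<lparr>carrier := C\<rparr>)"
  shows "subring W R"
proof (rule subringI)
  interpret C: cring "R\<lparr>carrier := C\<rparr>" by (rule subring_cring[OF C])
  have WC: "W \<subseteq> C" using subringE(1)[OF W] by simp
  then show "W \<subseteq> carrier R" using subringE(1)[OF C] by blast
  fix h assume h: "h \<in> W"
  have "\<ominus>\<^bsub>R\<lparr>carrier := C\<rparr>\<^esub> h = \<ominus> h"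
    using add.m_inv_consistent[OF subring.axioms(1)[OF C], of h] h WC
    unfolding a_inv_def by auto
  then show "\<ominus> h \<in> W" using subringE(5)[OF W h] by simp
qed (use subringE[OF W] in auto)

lemma (in cring) subring_of_subring:
  assumes C: "subring C R" and W: "subring W R" "W \<subseteq> C"
  shows "subring W (R\<lparr>carrier := C\<rparr>)"
proof -
  interpret C: cring "R\<lparr>carrier := C\<rparr>" by (rule subring_cring[OF C])
  show ?thesis
  proof (rule C.subringI)
    fix h assume h: "h \<in> W"
    have "\<ominus>\<^bsub>R\<lparr>carrier := C\<rparr>\<^esub> h = \<ominus> h"
      using add.m_inv_consistent[OF subring.axioms(1)[OF C], of h] h W(2)
      unfolding a_inv_def by auto
    then show "\<ominus>\<^bsub>R\<lparr>carrier := C\<rparr>\<^esub> h \<in> W" using subringE(5)[OF W(1) h] by simp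
  qed (use subringE[OF W(1)] W(2) in auto)
qed

lemma integral_extension_mono:
  assumes "integral_extension U S" "U \<subseteq> V"
  shows "integral_extension V S"
  using assms unfolding integral_extension_def by blast

lemma (in cring) integral_extension_restrict:
  assumes "integral_extension U R" "subring C R"
  shows "integral_extension U (R\<lparr>carrier := C\<rparr>)"
  using assms(1) subringE(1)[OF assms(2)] unfolding integral_extension_def
  by (auto simp: eval_consistent[OF assms(2)])

lemma residually_trivial_at_mono:
  assumes "residually_trivial_at U S Q" "U \<subseteq> V"
  shows "residually_trivial_at V S Q"
  using assms unfolding residually_trivial_at_def by (meson DiffD1 DiffD2 DiffI subsetD)

lemma (in cring) residually_trivial_at_restrict:
  assumes "residually_trivial_at U R N" and C: "subring C R" and U: "U \<subseteq> C"
  shows "residually_trivial_at U (R\<lparr>carrier := C\<rparr>) (N \<inter> C)"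
  unfolding residually_trivial_at_def
proof
  fix y assume "y \<in> carrier (R\<lparr>carrier := C\<rparr>)"
  then have y: "y \<in> C" "y \<in> carrier R" using subringE(1)[OF C] by auto
  then obtain s b where sb: "s \<in> U" "s \<notin> N" "b \<in> U" "s \<otimes> y \<ominus> b \<in> N"
    using assms(1) unfolding residually_trivial_at_def by blast
  have sy: "s \<otimes> y \<in> C" using sb y U subringE(6)[OF C] by auto
  have "s \<otimes> y \<ominus>\<^bsub>R\<lparr>carrier := C\<rparr>\<^esub> b \<in> N \<inter> C"
    using subring_minus_consistent[OF C sy] subring_minus_closed[OF C sy] sb U by auto
  then show "\<exists>s\<in>U - N \<inter> C. \<exists>b\<in>U. s \<otimes>\<^bsub>R\<lparr>carrier := C\<rparr>\<^esub> y \<ominus>\<^bsub>R\<lparr>carrier := C\<rparr>\<^esub> b \<in> N \<inter> C"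
    using sb by auto
qed

text \<open>The class of \<open>y\<close> is \<open>b/s\<close>. A denominator invertible modulo
  \<open>N\<close> has its inverse already in \<open>T\<close>: \<open>integral_relation\<close>
  with \<open>c = \<one>\<close> yields \<open>r\<close> in \<open>T\<close> with
  \<open>\<one> \<oplus> s \<otimes> r\<close> in \<open>N\<close>, so \<open>y\<close> is congruent
  to \<open>- r b\<close>.\<close>

lemma (in cring) residue_surj:
  assumes T: "subring T R" "integral_extension T R" and N: "ideal N R"
    and res: "residually_trivial_at T R N"
    and inv: "\<And>a. a \<in> T \<Longrightarrow> a \<notin> N \<Longrightarrow> \<exists>s \<in> carrier R. a \<otimes> s \<ominus> \<one> \<in> N"
    and y: "y \<in> carrier R"
  shows "\<exists>t \<in> T. y \<ominus> t \<in> N"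
proof -
  interpret N: ideal N R by fact
  obtain s b where s: "s \<in> T" "s \<notin> N" "b \<in> T" "s \<otimes> y \<ominus> b \<in> N"
    using res y unfolding residually_trivial_at_def by blast
  obtain s' where "s' \<in> carrier R" "s \<otimes> s' \<ominus> \<one> \<in> N" using inv s by blast
  then obtain n r where r: "r \<in> T" "\<one> [^] (n::nat) \<oplus> s \<otimes> r \<in> N"
    using integral_relation[OF T(1) N T(2) s(1) subringE(3)[OF T(1)]] by blast
  have c: "s \<in> carrier R" "b \<in> carrier R" "r \<in> carrier R"
    using s r subringE(1)[OF T(1)] by auto
  have "y \<ominus> (\<ominus> (r \<otimes> b)) = y \<otimes> (\<one> \<oplus> s \<otimes> r) \<oplus> (\<ominus> r) \<otimes> (s \<otimes> y \<ominus> b)"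
    using c y by algebra
  also have "\<dots> \<in> N"
    using N.I_l_closed[of "\<one> \<oplus> s \<otimes> r" y] N.I_l_closed[of "s \<otimes> y \<ominus> b" "\<ominus> r"] r s c y
    by (intro N.a_closed) auto
  finally show ?thesis using subringE(5,6)[OF T(1)] r s by blast
qed

text \<open>\<open>minimal_extension\<close> is interpreted with \<open>C\<close> as ambient ring
  and its results are rewritten in terms of \<open>R\<close>. Residual triviality is given at primes
  of \<open>R\<close>; by lying over, every prime of \<open>C\<close> is a contraction of one of
  these.\<close>

lemma (in cring) cover_structure:
  assumes U: "subring U R" "integral_extension U R"
      "\<forall>N. primeideal N R \<longrightarrow> residually_trivial_at U R N"
    and B: "subring B R" "U \<subseteq> B" and C: "subring C R" "B \<subset> C"
    and cover: "\<forall>W. subring W R \<longrightarrow> B \<subseteq> W \<longrightarrow> W \<subseteq> C \<longrightarrow> W = B \<or> W = C"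
  obtains x I where "x \<in> C" "x \<notin> B" "I = {a \<in> C. \<forall>r \<in> C. a \<otimes> r \<in> B}"
    "I \<subseteq> B" "ideal I (R\<lparr>carrier := C\<rparr>)" "primeideal I (R\<lparr>carrier := B\<rparr>)"
    "x \<otimes> x \<in> I \<or> x \<otimes> x \<ominus> x \<in> I"
    "\<forall>c \<in> C. \<exists>b \<in> B. \<exists>d \<in> B. c = b \<oplus> d \<otimes> x"
    "\<forall>b \<in> B. b \<otimes> x \<in> B \<longrightarrow> b \<in> I"
    "\<forall>a \<in> B. a \<notin> I \<longrightarrow> (\<exists>b \<in> B. a \<otimes> b \<ominus> \<one> \<in> I)"
proof -
  let ?C = "R\<lparr>carrier := C\<rparr>"
  interpret C: cring ?C by (rule subring_cring[OF C(1)])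
  interpret C: minimal_extension ?C B
  proof (intro minimal_extension.intro minimal_extension_axioms.intro)
    show "cring ?C" by (rule C.is_cring)
    show "subring B ?C" using subring_of_subring[OF C(1) B(1)] C(2) by blast
    show "B \<noteq> carrier ?C" using C(2) by simp
    show "W = B \<or> W = carrier ?C" if "subring W ?C" "B \<subseteq> W" for W
      using cover[rule_format, OF subring_subring[OF C(1) that(1)] that(2)] subringE(1)[OF that(1)] by simp
  qed
  have "residually_trivial_at B ?C Q" if Q: "primeideal Q ?C" for Q
  proof -
    obtain N where N: "primeideal N R" "N \<inter> C = Q"
      using lying_over[OF C(1) integral_extension_mono[OF U(2)] Q] B C by blast
    show ?thesis
      using residually_trivial_at_mono[OF
          residually_trivial_at_restrict[OF U(3)[rule_format, OF N(1)] C(1)] B(2)] B C N by blast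
  qed
  then obtain x where x: "x \<in> carrier ?C - B"
      and xx: "x \<otimes>\<^bsub>?C\<^esub> x \<in> C.I \<or> x \<otimes>\<^bsub>?C\<^esub> x \<ominus>\<^bsub>?C\<^esub> x \<in> C.I"
    using C.exists_generator[OF integral_extension_restrict[OF integral_extension_mono[OF U(2) B(2)] C(1)]]
    by blast
  have x': "x \<in> carrier ?C" "x \<notin> B" using x by auto
  have I: "C.I = {a \<in> C. \<forall>r \<in> C. a \<otimes> r \<in> B}" unfolding conductor_def by simp
  have IB: "C.I \<subseteq> B" by (rule C.I_subset)
  have xx': "x \<otimes> x \<in> C.I \<or> x \<otimes> x \<ominus> x \<in> C.I"
    using xx subring_minus_consistent[OF C(1), of "x \<otimes> x" x] x' subringE(6)[OF C(1)] by auto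
  have inv: "\<exists>b \<in> B. a \<otimes> b \<ominus> \<one> \<in> C.I" if a: "a \<in> B" "a \<notin> C.I" for a
  proof -
    obtain b where b: "b \<in> B" "a \<otimes>\<^bsub>?C\<^esub> b \<ominus>\<^bsub>?C\<^esub> \<one>\<^bsub>?C\<^esub> \<in> C.I"
      using C.inverse_mod_I[OF x' xx a] .
    have "a \<otimes> b \<in> C" using a b C(2) subringE(6)[OF B(1)] by blast
    then show ?thesis
      using b subring_minus_consistent[OF C(1), of "a \<otimes> b" \<one>] subringE(3)[OF C(1)] by auto
  qed
  have Iadd: "a \<oplus> b \<in> C.I" if "a \<in> C.I" "b \<in> C.I" for a b
    using additive_subgroup.a_closed[OF C.I.additive_subgroup_axioms that] by simp
  have Imult: "c \<otimes> a \<in> C.I" if "a \<in> C.I" "c \<in> C" for a c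
    using C.I.I_l_closed that by simp
  have prime: "primeideal C.I (R\<lparr>carrier := B\<rparr>)"
  proof (rule primeidealI)
    interpret B: cring "R\<lparr>carrier := B\<rparr>" by (rule subring_cring[OF B(1)])
    show "cring (R\<lparr>carrier := B\<rparr>)" by (rule B.is_cring)
    show "ideal C.I (R\<lparr>carrier := B\<rparr>)"
    proof (rule B.ideal_memI)
      show "\<zero>\<^bsub>R\<lparr>carrier := B\<rparr>\<^esub> \<in> C.I"
        using additive_subgroup.zero_closed[OF C.I.additive_subgroup_axioms] by simp
    qed (use IB Iadd Imult C(2) in auto)
    show "carrier (R\<lparr>carrier := B\<rparr>) \<noteq> C.I"
      using C.one_notin_I subringE(3)[OF B(1)] by auto
    fix a b assume "a \<in> carrier (R\<lparr>carrier := B\<rparr>)" "b \<in> carrier (R\<lparr>carrier := B\<rparr>)"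
      "a \<otimes>\<^bsub>R\<lparr>carrier := B\<rparr>\<^esub> b \<in> C.I"
    then show "a \<in> C.I \<or> b \<in> C.I" using C.I_prime[of a b] by auto
  qed
  have "\<exists>b \<in> B. \<exists>d \<in> B. c = b \<oplus> d \<otimes> x" if "c \<in> C" for c
    by (rule C.generator_decomp[OF x' xx, of c]) (use that in auto)
  moreover have "b \<in> C.I" if "b \<in> B" "b \<otimes> x \<in> B" for b
    using C.mult_generator_in_B[OF x' xx, of b] that by simp
  ultimately show ?thesis
    using that[OF _ _ I IB C.I.ideal_axioms prime xx'] x' inv by auto
qed

text \<open>The quotient \<open>C/B\<close> is isomorphic to \<open>B/I\<close>, onto which
  \<open>T\<close> surjects, so it is a simple \<open>T\<close>-module. Hence a single element of
  \<open>Y\<close> outside \<open>B\<close> already generates \<open>C\<close> modulo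
  \<open>B\<close> over \<open>T\<close>.\<close>

lemma (in cring) cover_add:
  assumes T: "subring T R" "integral_extension T R"
      "\<forall>N. primeideal N R \<longrightarrow> residually_trivial_at T R N"
    and B: "subring B R" "T \<subseteq> B" and C: "subring C R" "B \<subset> C"
    and cover: "\<forall>W. subring W R \<longrightarrow> B \<subseteq> W \<longrightarrow> W \<subseteq> C \<longrightarrow> W = B \<or> W = C"
    and Y: "subring Y R" "T \<subseteq> Y" "Y \<subseteq> C" "\<not> Y \<subseteq> B" and z: "z \<in> C"
  shows "\<exists>y \<in> Y. \<exists>b \<in> B. z = y \<oplus> b"
proof -
  obtain x I where x: "x \<in> C" "x \<notin> B" and "I = {a \<in> C. \<forall>r \<in> C. a \<otimes> r \<in> B}" and IB: "I \<subseteq> B"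
    and I: "ideal I (R\<lparr>carrier := C\<rparr>)" "primeideal I (R\<lparr>carrier := B\<rparr>)"
    and "x \<otimes> x \<in> I \<or> x \<otimes> x \<ominus> x \<in> I"
    and decomp: "\<forall>c \<in> C. \<exists>b \<in> B. \<exists>d \<in> B. c = b \<oplus> d \<otimes> x"
    and "\<forall>b \<in> B. b \<otimes> x \<in> B \<longrightarrow> b \<in> I"
    and inv: "\<forall>a \<in> B. a \<notin> I \<longrightarrow> (\<exists>b \<in> B. a \<otimes> b \<ominus> \<one> \<in> I)"
    by (rule cover_structure[OF T B C cover])
  note BE = subringE[OF B(1)] and YE = subringE[OF Y(1)]
  have Bc: "b \<in> carrier R" if "b \<in> B" for b using that BE(1) by blast
  have Yc: "b \<in> carrier R" if "b \<in> Y" for b using that YE(1) by blast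
  have xc: "x \<in> carrier R" using x subringE(1)[OF C(1)] by blast
  have Ix: "i \<otimes> x \<in> B" if "i \<in> I" for i
    using ideal.I_r_closed[OF I(1) that, of x] x IB by auto
  obtain N where N: "primeideal N R" "N \<inter> B = I"
    using lying_over[OF B(1) integral_extension_mono[OF T(2) B(2)] I(2)] .
  interpret N: primeideal N R by (rule N(1))
  have surj: "\<exists>t \<in> T. b \<ominus> t \<in> I" if b: "b \<in> B" for b
  proof -
    have "\<exists>s \<in> carrier R. a \<otimes> s \<ominus> \<one> \<in> N" if "a \<in> T" "a \<notin> N" for a
      using inv that N(2) B(2) Bc by blast
    then obtain t where "t \<in> T" "b \<ominus> t \<in> N"
      using residue_surj[OF T(1,2) N.ideal_axioms T(3)[rule_format, OF N(1)] _ Bc[OF b]] by blast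
    then show ?thesis using N(2) subring_minus_closed[OF B(1) b] B(2) by blast
  qed
  obtain y where y: "y \<in> Y" "y \<notin> B" using Y by blast
  obtain a b where ab: "a \<in> B" "b \<in> B" "y = a \<oplus> b \<otimes> x" using decomp y Y(3) by blast
  have "b \<notin> I" using ab y(2) Ix BE(7) by auto
  then obtain b' where b': "b' \<in> B" "b \<otimes> b' \<ominus> \<one> \<in> I" using inv ab by blast
  \<comment> \<open>\<open>\<tau>\<close> inverts the coefficient \<open>b\<close> of
    \<open>x\<close> in \<open>y\<close> modulo \<open>I\<close>, so \<open>\<tau> y\<close> agrees
    with \<open>x\<close> modulo \<open>B\<close>. With \<open>\<delta>\<close> standing for the
    coefficient of \<open>x\<close> in \<open>z\<close>, the product
    \<open>\<delta> \<tau> y\<close> agrees with \<open>z\<close> modulo \<open>B\<close>;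
    \<open>w\<close> is the error.\<close>
  obtain \<tau> where \<tau>: "\<tau> \<in> T" "b' \<ominus> \<tau> \<in> I" using surj b' by blast
  obtain c d where cd: "c \<in> B" "d \<in> B" "z = c \<oplus> d \<otimes> x" using decomp z by blast
  obtain \<delta> where \<delta>: "\<delta> \<in> T" "d \<ominus> \<delta> \<in> I" using surj cd by blast
  have car: "a \<in> carrier R" "b \<in> carrier R" "b' \<in> carrier R" "\<tau> \<in> carrier R"
      "c \<in> carrier R" "d \<in> carrier R" "\<delta> \<in> carrier R"
    using ab b' \<tau> cd \<delta> Bc B(2) by auto
  define i where "i = b \<otimes> \<tau> \<ominus> \<one>"
  have "i = (b \<otimes> b' \<ominus> \<one>) \<oplus> \<ominus> (b \<otimes> (b' \<ominus> \<tau>))" unfolding i_def using car by algebra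
  then have "i \<in> N"
    using N.a_closed N.a_inv_closed N.I_l_closed[OF _ car(2)] b' \<tau> N(2) by auto
  then have iI: "i \<in> I"
    unfolding i_def using N(2) subring_minus_closed[OF B(1)] BE(3,6) ab \<tau> B(2) by blast
  have ic: "i \<in> carrier R" using iI IB Bc by blast
  have "b \<otimes> \<tau> = i \<oplus> \<one>" unfolding i_def using car by algebra
  then have bx: "b \<otimes> \<tau> \<otimes> x = i \<otimes> x \<oplus> x" using ic xc by (simp add: l_distr)
  have "\<delta> \<otimes> (\<tau> \<otimes> y) = \<delta> \<otimes> (\<tau> \<otimes> a) \<oplus> \<delta> \<otimes> (b \<otimes> \<tau> \<otimes> x)"
    unfolding ab(3) using car xc by algebra
  also have "\<dots> = \<delta> \<otimes> (\<tau> \<otimes> a) \<oplus> \<delta> \<otimes> (i \<otimes> x \<oplus> x)" by (simp only: bx)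
  finally have eq: "\<delta> \<otimes> (\<tau> \<otimes> y) = \<delta> \<otimes> (\<tau> \<otimes> a) \<oplus> \<delta> \<otimes> (i \<otimes> x \<oplus> x)" .
  define w where "w = c \<oplus> ((d \<ominus> \<delta>) \<otimes> x \<oplus> \<ominus> (\<delta> \<otimes> (\<tau> \<otimes> a) \<oplus> \<delta> \<otimes> (i \<otimes> x)))"
  have "z = \<delta> \<otimes> (\<tau> \<otimes> a) \<oplus> \<delta> \<otimes> (i \<otimes> x \<oplus> x) \<oplus> w"
    unfolding cd(3) w_def using car xc ic by algebra
  then have "z = \<delta> \<otimes> (\<tau> \<otimes> y) \<oplus> w" using eq by simp
  moreover have "\<delta> \<otimes> (\<tau> \<otimes> y) \<in> Y" using YE(6) y \<delta> \<tau> Y(2) by blast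
  moreover have "w \<in> B"
    unfolding w_def using cd(1) Ix[OF \<delta>(2)] Ix[OF iI] \<delta>(1) \<tau>(1) B(2) ab(1)
    by (simp add: BE(5,6,7) subsetD)
  ultimately show ?thesis by blast
qed

section \<open>Chains of intermediate rings\<close>

lemma finite_chain_least:
  assumes "finite C" "C \<noteq> {}" "subset.chain A C"
  obtains m where "m \<in> C" "\<forall>W \<in> C. m \<subseteq> W"
proof -
  obtain m where m: "m \<in> C" "\<forall>W \<in> C. W \<subseteq> m \<longrightarrow> m = W"
    using finite_has_minimal[OF assms(1,2)] by blast
  have "m \<subseteq> W" if "W \<in> C" for W
    using subset_chain_def[THEN iffD1, OF assms(3)] m that by (metis subset_refl)
  then show ?thesis by (intro that[OF m(1)]) blast
qed

lemma finite_chain_greatest: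
  assumes "finite C" "C \<noteq> {}" "subset.chain A C"
  obtains m where "m \<in> C" "\<forall>W \<in> C. W \<subseteq> m"
proof -
  obtain m where m: "m \<in> C" "\<forall>W \<in> C. m \<subseteq> W \<longrightarrow> m = W"
    using finite_has_maximal[OF assms(1,2)] by blast
  have "W \<subseteq> m" if "W \<in> C" for W
    using subset_chain_def[THEN iffD1, OF assms(3)] m that by (metis subset_refl)
  then show ?thesis by (intro that[OF m(1)]) blast
qed

lemma maxchain_memI:
  assumes "subset.maxchain A C" "W \<in> A" "\<And>V. V \<in> C \<Longrightarrow> V \<subseteq> W \<or> W \<subseteq> V"
  shows "W \<in> C"
proof (rule ccontr)
  assume "W \<notin> C"
  moreover have "subset.chain A (insert W C)"
    using assms unfolding subset.maxchain_def subset_chain_def by auto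
  ultimately show False using assms(1) unfolding subset.maxchain_def by blast
qed

text \<open>Hausdorff's principle, applied only to the members of \<open>A\<close> comparable with
  all of \<open>C\<close>, gives a chain that must contain \<open>C\<close> and is still maximal in
  \<open>A\<close>.\<close>

lemma chain_extends_to_maxchain:
  assumes C: "subset.chain A C"
  obtains D where "subset.maxchain A D" "C \<subseteq> D"
proof -
  let ?A = "{W \<in> A. \<forall>V \<in> C. V \<subseteq> W \<or> W \<subseteq> V}"
  obtain D where D: "subset.maxchain ?A D" using subset.Hausdorff by blast
  then have chD: "subset.chain ?A D" unfolding subset.maxchain_def by blast
  have CD: "C \<subseteq> D"
  proof
    fix W assume W: "W \<in> C"
    show "W \<in> D"
    proof (rule maxchain_memI[OF D])
      show "W \<in> ?A" using C W unfolding subset_chain_def by blast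
      show "V \<subseteq> W \<or> W \<subseteq> V" if "V \<in> D" for V
        using chD W that unfolding subset_chain_def by blast
    qed
  qed
  have "subset.maxchain A D"
    unfolding subset.maxchain_def
  proof (intro conjI notI)
    show "subset.chain A D" using chD unfolding subset_chain_def by blast
    assume "\<exists>E. subset.chain A E \<and> D \<subset> E"
    then obtain E where E: "subset.chain A E" "D \<subset> E" by blast
    then have "subset.chain ?A E" using CD unfolding subset_chain_def by blast
    then show False using D E(2) unfolding subset.maxchain_def by blast
  qed
  then show ?thesis using that CD by blast
qed

lemma interm_rings_mono: "T \<subseteq> U \<Longrightarrow> interm_rings U S \<subseteq> interm_rings T S"
  unfolding interm_rings_def by blast

lemma FCP_mono:
  assumes "FCP T S" "T \<subseteq> U" shows "FCP U S"
  unfolding FCP_def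
proof (intro allI impI)
  fix C assume "subset.chain (interm_rings U S) C"
  then have "subset.chain (interm_rings T S) C"
    using interm_rings_mono[OF assms(2), of S] unfolding subset_chain_def by auto
  then show "finite C" using assms(1) unfolding FCP_def by blast
qed

lemma FCP_exists_minimal:
  assumes "FCP T S" "A \<subseteq> interm_rings T S" "A \<noteq> {}"
  obtains M where "M \<in> A" "\<And>W. W \<in> A \<Longrightarrow> W \<subseteq> M \<Longrightarrow> W = M"
proof -
  obtain C where C: "subset.maxchain A C" using subset.Hausdorff by blast
  then have ch: "subset.chain A C" unfolding subset.maxchain_def by blast
  then have "subset.chain (interm_rings T S) C"
    using assms(2) unfolding subset_chain_def by auto
  then have fin: "finite C" using assms(1) unfolding FCP_def by blast
  have "C \<noteq> {}" using maxchain_memI[OF C] assms(3) by blast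
  then obtain m where m: "m \<in> C" "\<forall>W \<in> C. m \<subseteq> W"
    using finite_chain_least[OF fin _ ch] by blast
  have "W = m" if "W \<in> A" "W \<subseteq> m" for W
    using maxchain_memI[OF C that(1)] m that(2) by blast
  then show ?thesis using that m(1) ch unfolding subset_chain_def by blast
qed

lemma FCP_exists_maximal:
  assumes "FCP T S" "A \<subseteq> interm_rings T S" "A \<noteq> {}"
  obtains M where "M \<in> A" "\<And>W. W \<in> A \<Longrightarrow> M \<subseteq> W \<Longrightarrow> W = M"
proof -
  obtain C where C: "subset.maxchain A C" using subset.Hausdorff by blast
  then have ch: "subset.chain A C" unfolding subset.maxchain_def by blast
  then have "subset.chain (interm_rings T S) C"
    using assms(2) unfolding subset_chain_def by auto
  then have fin: "finite C" using assms(1) unfolding FCP_def by blast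
  have "C \<noteq> {}" using maxchain_memI[OF C] assms(3) by blast
  then obtain m where m: "m \<in> C" "\<forall>W \<in> C. W \<subseteq> m"
    using finite_chain_greatest[OF fin _ ch] by blast
  have "W = m" if "W \<in> A" "m \<subseteq> W" for W
    using maxchain_memI[OF C that(1)] m that(2) by blast
  then show ?thesis using that m(1) ch unfolding subset_chain_def by blast
qed

section \<open>Infra-integral extensions are catenarian\<close>

text \<open>
  Jordan--Hoelder: if \<open>M\<close> is covered by the top ring \<open>Z\<close> then \<open>Y + M = Z\<close> for every \<open>Y\<close> in \<open>[T, Z]\<close> not
  below \<open>M\<close>, so that intersecting a chain with \<open>M\<close> identifies at most two of its members.
\<close>

lemma (in cring) card_chain_le_card_maxchain:
  assumes T: "subring T R" "integral_extension T R"
      "\<forall>N. primeideal N R \<longrightarrow> residually_trivial_at T R N"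
    and FCP: "FCP T R" and Z: "Z \<in> interm_rings T R"
    and C: "subset.maxchain {W \<in> interm_rings T R. W \<subseteq> Z} C"
    and D: "subset.chain {W \<in> interm_rings T R. W \<subseteq> Z} D"
  shows "card D \<le> card C"
  using Z C D
proof (induction "card C" arbitrary: Z C D rule: less_induct)
  case less
  define L where "L = interm_rings T R"
  note C = less.prems(2)[folded L_def] and D = less.prems(3)[folded L_def]
  have ZL: "Z \<in> L" using less.prems(1) unfolding L_def .
  have TL: "T \<in> L" "\<And>W. W \<in> L \<Longrightarrow> T \<subseteq> W"
    using T(1) unfolding L_def interm_rings_def by auto
  have fin: "finite E" if "subset.chain {W \<in> L. W \<subseteq> V} E" for V E
  proof -
    have "subset.chain (interm_rings T R) E" using that unfolding subset_chain_def L_def by auto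
    then show ?thesis using FCP unfolding FCP_def by blast
  qed
  have chC: "subset.chain {W \<in> L. W \<subseteq> Z} C" using C unfolding subset.maxchain_def by blast
  note finC = fin[OF chC] and finD = fin[OF D]
  have CZ: "W \<in> L" "W \<subseteq> Z" if "W \<in> C" for W
    using chC that unfolding subset_chain_def by auto
  have DZ: "W \<in> L" "W \<subseteq> Z" if "W \<in> D" for W
    using D that unfolding subset_chain_def by auto
  have ZC: "Z \<in> C" by (rule maxchain_memI[OF C]) (use ZL CZ in auto)
  have TC: "T \<in> C" by (rule maxchain_memI[OF C]) (use TL CZ ZL in auto)
  show ?case
  proof (cases "Z = T")
    case True
    then have "D \<subseteq> {T}" using DZ TL by blast
    then have "card D \<le> 1" using card_mono[of "{T}" D] by simp
    also have "1 \<le> card C" using ZC finC by (metis Suc_leI card_gt_0_iff empty_iff One_nat_def)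
    finally show ?thesis .
  next
    case False
    \<comment> \<open>The induction descends to the second largest member \<open>M\<close> of
      \<open>C\<close>, below which \<open>C'\<close> is a maximal chain.\<close>
    define C' where "C' = C - {Z}"
    have chC': "subset.chain {W \<in> L. W \<subseteq> Z} C'"
      using chC unfolding subset_chain_def C'_def by blast
    have "C' \<noteq> {}" "finite C'" using TC False finC unfolding C'_def by auto
    then obtain M where M: "M \<in> C'" "\<forall>W \<in> C'. W \<subseteq> M"
      using finite_chain_greatest[OF _ _ chC'] by blast
    have MinL: "M \<in> L" and MZ: "M \<subset> Z" using M(1) CZ unfolding C'_def by auto
    have subrings: "subring W R" "T \<subseteq> W" if "W \<in> L" for W
      using that unfolding L_def interm_rings_def by auto
    have cover: "\<forall>W. subring W R \<longrightarrow> M \<subseteq> W \<longrightarrow> W \<subseteq> Z \<longrightarrow> W = M \<or> W = Z"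
    proof (intro allI impI)
      fix W assume W: "subring W R" "M \<subseteq> W" "W \<subseteq> Z"
      have WL: "W \<in> L" using W subrings[OF MinL] unfolding L_def interm_rings_def by blast
      have "W \<in> C"
      proof (rule maxchain_memI[OF C])
        show "W \<in> {W \<in> L. W \<subseteq> Z}" using WL W by blast
        show "V \<subseteq> W \<or> W \<subseteq> V" if "V \<in> C" for V
          using that W M(2) unfolding C'_def by blast
      qed
      then show "W = M \<or> W = Z" using M(2) W unfolding C'_def by blast
    qed
    have maxC': "subset.maxchain {W \<in> L. W \<subseteq> M} C'"
      unfolding subset.maxchain_def
    proof (intro conjI notI)
      show "subset.chain {W \<in> L. W \<subseteq> M} C'"
        using chC' M(2) unfolding subset_chain_def by blast
      assume "\<exists>E. subset.chain {W \<in> L. W \<subseteq> M} E \<and> C' \<subset> E"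
      then obtain E where E: "subset.chain {W \<in> L. W \<subseteq> M} E" "C' \<subset> E" by blast
      have EM: "W \<in> L" "W \<subseteq> M" if "W \<in> E" for W
        using E(1) that unfolding subset_chain_def by auto
      have "subset.chain {W \<in> L. W \<subseteq> Z} (insert Z E)"
        using E(1) MZ ZL EM unfolding subset_chain_def by blast
      moreover have "C \<subset> insert Z E"
      proof -
        obtain W where W: "W \<in> E" "W \<notin> C'" using E(2) by blast
        have "W \<noteq> Z" using EM(2)[OF W(1)] MZ by blast
        then show ?thesis using W E(2) unfolding C'_def by blast
      qed
      ultimately show False using C unfolding subset.maxchain_def by blast
    qed
    have card': "card C = Suc (card C')"
      unfolding C'_def using finC ZC by (metis card_Suc_Diff1)
    have inter: "W \<inter> M \<in> L" if "W \<in> L" for W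
      using subring_inter subrings[OF that] subrings[OF MinL]
      unfolding L_def interm_rings_def by blast
    let ?f = "\<lambda>W. W \<inter> M"
    have "subset.chain {W \<in> L. W \<subseteq> M} (?f ` D)"
      using D inter unfolding subset_chain_def by blast
    then have IH: "card (?f ` D) \<le> card C'"
      using less.hyps[of C' M "?f ` D"] card' MinL maxC' unfolding L_def by simp
    have comp: "V \<subseteq> W \<or> W \<subseteq> V" if "V \<in> D" "W \<in> D" for V W
      using D that unfolding subset_chain_def by blast
    \<comment> \<open>Members not below \<open>M\<close> are determined by their trace on
      \<open>M\<close>: an element of \<open>W\<close> is \<open>v \<oplus> x\<close> with
      \<open>v \<in> V\<close> and \<open>x \<in> M\<close>, and if \<open>V \<subseteq> W\<close>
      then \<open>x\<close> lies in the common trace, hence in \<open>V\<close>.\<close>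
    have le: "W \<subseteq> V" if V: "V \<in> D" "\<not> V \<subseteq> M" and W: "W \<in> D" and eq: "V \<inter> M = W \<inter> M" for V W
    proof
      fix w assume w: "w \<in> W"
      have "w \<in> Z" using w DZ(2)[OF W] by blast
      then obtain v x where vx: "v \<in> V" "x \<in> M" "w = v \<oplus> x"
        using cover_add[OF T subrings[OF MinL] subrings(1)[OF ZL] MZ cover
            subrings[OF DZ(1)[OF V(1)]] DZ(2)[OF V(1)] V(2)] by blast
      show "w \<in> V"
      proof (cases "W \<subseteq> V")
        case True
        then show ?thesis using w by blast
      next
        case False
        then have "v \<in> W" using comp[OF V(1) W] vx(1) by blast
        then have "w \<ominus> v \<in> W" using subring_minus_closed[OF subrings(1)[OF DZ(1)[OF W]] w] by blast
        moreover have "w \<ominus> v = x"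
        proof -
          have "v \<in> carrier R" "x \<in> carrier R"
            using vx subringE(1)[OF subrings(1)] DZ(1)[OF V(1)] MinL by auto
          then show ?thesis unfolding vx(3) by algebra
        qed
        ultimately have "x \<in> V" using vx(2) eq by blast
        then show ?thesis
          unfolding vx(3) using subringE(7)[OF subrings(1)[OF DZ(1)[OF V(1)]] vx(1)] by blast
      qed
    qed
    show ?thesis
    proof (cases "\<exists>V \<in> D. \<not> V \<subseteq> M")
      case False
      then have "?f ` D = D" by (auto simp: image_iff Int_absorb2)
      then show ?thesis using IH card' by simp
    next
      case True
      let ?D2 = "{V \<in> D. \<not> V \<subseteq> M}"
      have neD2: "?D2 \<noteq> {}" using True by blast
      have finD2: "finite ?D2" using finD by simp
      have "subset.chain {W \<in> L. W \<subseteq> Z} ?D2" using D unfolding subset_chain_def by blast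
      then obtain m where m: "m \<in> ?D2" "\<forall>W \<in> ?D2. m \<subseteq> W"
        by (rule finite_chain_least[OF finD2 neD2])
      \<comment> \<open>Only the least member \<open>m\<close> not below \<open>M\<close> can share
        its trace with a member below \<open>M\<close>: for any other such \<open>W\<close>, the
        ring \<open>m\<close> lies between and has the trace of \<open>W\<close> too, whence
        \<open>W \<subseteq> m\<close> by \<open>le\<close>. Dropping \<open>m\<close> therefore
        makes the trace map injective.\<close>
      have mixed: False if "V \<in> D" "V \<subseteq> M" "W \<in> D - {m}" "\<not> W \<subseteq> M" "V \<inter> M = W \<inter> M" for V W
      proof -
        have "V \<subseteq> m" using comp[of V m] m(1) that by blast
        moreover have mW: "m \<subseteq> W" using m(2) that by blast
        ultimately have "m \<inter> M = W \<inter> M" using that by blast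
        then show False using le[of m W] m(1) mW that by blast
      qed
      have "inj_on ?f (D - {m})"
      proof (rule inj_onI)
        fix V W assume VW: "V \<in> D - {m}" "W \<in> D - {m}" "V \<inter> M = W \<inter> M"
        consider "V \<subseteq> M" "W \<subseteq> M" | "V \<subseteq> M" "\<not> W \<subseteq> M" | "\<not> V \<subseteq> M" "W \<subseteq> M"
          | "\<not> V \<subseteq> M" "\<not> W \<subseteq> M" by blast
        then show "V = W"
        proof cases
          case 1
          then show ?thesis using VW(3) by blast
        next
          case 2
          then show ?thesis using mixed[of V W] VW by blast
        next
          case 3
          then show ?thesis using mixed[of W V] VW by blast
        next
          case 4
          then show ?thesis using le[of V W] le[of W V] VW by blast
        qed
      qed
      then have "card (D - {m}) \<le> card (?f ` D)"
        using card_inj_on_le[of ?f "D - {m}" "?f ` D"] finD by blast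
      moreover have "card D = Suc (card (D - {m}))"
        using m(1) finD by (metis (mono_tags, lifting) card_Suc_Diff1 mem_Collect_eq)
      ultimately show ?thesis using IH card' by simp
    qed
  qed
qed

lemma (in cring) infra_integral_imp_catenarian:
  assumes T: "subring T R" and infra: "infra_integral T R" and FCP: "FCP T R"
  shows "catenarian T R"
proof -
  have inf: "integral_extension T R" "\<forall>N. primeideal N R \<longrightarrow> residually_trivial_at T R N"
    using infra infra_integral_iff[OF is_cring T] by auto
  have eq: "{W \<in> interm_rings T R. W \<subseteq> carrier R} = interm_rings T R"
    using subringE(1) unfolding interm_rings_def by blast
  have top: "carrier R \<in> interm_rings T R"
    using carrier_is_subring subringE(1)[OF T] unfolding interm_rings_def by blast
  have "card D \<le> card C"
    if "subset.maxchain (interm_rings T R) C" "subset.maxchain (interm_rings T R) D" for C D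
    using card_chain_le_card_maxchain[OF T inf FCP top, unfolded eq, OF that(1)] that(2)
    unfolding subset.maxchain_def by blast
  then have "chain_length C = chain_length D"
    if "subset.maxchain (interm_rings T R) C" "subset.maxchain (interm_rings T R) D" for C D
    using that unfolding chain_length_def by (metis le_antisym)
  then show ?thesis unfolding catenarian_def using FCP by blast
qed

section \<open>Catenarian extensions\<close>

text \<open>
  Suppose \<open>V' = V + I \<noteq> B\<close>, and take a maximal chain through \<open>V' \<subset> B \<subset> C\<close>. Replacing its members
  \<open>F\<close> between \<open>V'\<close> and \<open>B\<close> by the rings \<open>F + Bx\<close> leaves room for the additional member \<open>V' + V'x\<close>,
  which makes the chain longer.
\<close>

lemma (in cring) catenarian_cover_residue:
  assumes cat: "catenarian T R"
    and U: "subring U R" "integral_extension U R"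
      "\<forall>N. primeideal N R \<longrightarrow> residually_trivial_at U R N"
    and B: "subring B R" "U \<subseteq> B" and C: "subring C R" "B \<subset> C"
    and cover: "\<forall>W. subring W R \<longrightarrow> B \<subseteq> W \<longrightarrow> W \<subseteq> C \<longrightarrow> W = B \<or> W = C"
    and V: "subring V R" "T \<subseteq> V" "V \<subseteq> B" and b: "b \<in> B"
  shows "\<exists>v \<in> V. b \<ominus> v \<in> {a \<in> C. \<forall>r \<in> C. a \<otimes> r \<in> B}"
proof -
  obtain x I where x: "x \<in> C" "x \<notin> B" and I_def: "I = {a \<in> C. \<forall>r \<in> C. a \<otimes> r \<in> B}"
    and IB: "I \<subseteq> B" and I: "ideal I (R\<lparr>carrier := C\<rparr>)" "primeideal I (R\<lparr>carrier := B\<rparr>)"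
    and xx: "x \<otimes> x \<in> I \<or> x \<otimes> x \<ominus> x \<in> I"
    and decomp: "\<forall>c \<in> C. \<exists>b \<in> B. \<exists>d \<in> B. c = b \<oplus> d \<otimes> x"
    and multx: "\<forall>b \<in> B. b \<otimes> x \<in> B \<longrightarrow> b \<in> I"
    and inv: "\<forall>a \<in> B. a \<notin> I \<longrightarrow> (\<exists>b \<in> B. a \<otimes> b \<ominus> \<one> \<in> I)"
    by (rule cover_structure[OF U B C cover])
  let ?C = "R\<lparr>carrier := C\<rparr>"
  interpret C: cring ?C by (rule subring_cring[OF C(1)])
  interpret I: ideal I ?C by (rule I(1))
  note BE = subringE[OF B(1)] and CE = subringE[OF C(1)] and VE = subringE[OF V(1)]
  have Bc: "a \<in> carrier R" if "a \<in> B" for a using that BE(1) by blast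
  have xc: "x \<in> carrier R" using x CE(1) by blast
  have Ix: "i \<otimes> x \<in> I" if "i \<in> I" for i
    using I.I_r_closed[OF that, of x] x by simp
  have I0: "\<zero> \<in> I" using additive_subgroup.zero_closed[OF I.additive_subgroup_axioms] by simp
  have xx': "x \<otimes>\<^bsub>?C\<^esub> x \<in> I \<or> x \<otimes>\<^bsub>?C\<^esub> x \<ominus>\<^bsub>?C\<^esub> x \<in> I"
    using xx subring_minus_consistent[OF C(1), of "x \<otimes> x" x] x CE(6) by auto
  \<comment> \<open>Enlarging \<open>V\<close> by the conductor \<open>I\<close> makes it possible
    to adjoin multiples of \<open>x\<close>; the claim becomes \<open>V' = B\<close>.\<close>
  define V' where "V' = {v \<oplus> i | v i. v \<in> V \<and> i \<in> I}"
  have VC: "subring V ?C" using subring_of_subring[OF C(1) V(1)] V(3) C(2) by blast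
  have V': "subring V' R"
    using subring_subring[OF C(1) C.subring_add_ideal[OF VC I(1)]] unfolding V'_def by simp
  note V'E = subringE[OF V']
  have VV': "V \<subseteq> V'"
  proof
    fix v assume v: "v \<in> V"
    then have "v = v \<oplus> \<zero>" using VE(1) by auto
    then show "v \<in> V'" unfolding V'_def using v I0 by blast
  qed
  have IV': "I \<subseteq> V'"
  proof
    fix i assume i: "i \<in> I"
    then have "i = \<zero> \<oplus> i" using IB Bc by auto
    then show "i \<in> V'" unfolding V'_def using i VE(2) by blast
  qed
  have V'B: "V' \<subseteq> B" unfolding V'_def using V(3) IB BE(7) by auto
  have "V' = B"
  proof (rule ccontr)
    assume V'neB: "V' \<noteq> B"
    \<comment> \<open>The ring \<open>F + Gx\<close> is needed for
      \<open>V' \<subseteq> F \<subseteq> G \<subseteq> B\<close>: with \<open>G = B\<close> to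
      transport the chain, and with \<open>F = G = V'\<close> for the additional member.\<close>
    define g where "g F G = {f \<oplus> b \<otimes> x | f b. f \<in> F \<and> b \<in> G}" for F G
    have g_subring: "subring (g F G) R"
      if F: "subring F R" "V' \<subseteq> F" "F \<subseteq> B" and G: "subring G R" "F \<subseteq> G" "G \<subseteq> B" for F G
    proof -
      have "subring {f \<oplus>\<^bsub>?C\<^esub> b \<otimes>\<^bsub>?C\<^esub> x | f b. f \<in> F \<and> b \<in> G} ?C"
      proof (rule C.subring_adjoin[OF _ I(1) _ _ _ _ _ _ _ xx'])
        show "subring F ?C" using subring_of_subring[OF C(1) F(1)] F(3) C(2) by blast
        show "I \<subseteq> F" using IV' F(2) by blast
        show "G \<subseteq> carrier ?C" using G(3) C(2) by auto
      qed (use subringE[OF G(1)] G(2) x in auto)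
      then show ?thesis using subring_subring[OF C(1)] unfolding g_def by simp
    qed
    have g_upper: "F \<subseteq> g F G" if "F \<subseteq> B" "\<zero> \<in> G" for F G
    proof
      fix f assume f: "f \<in> F"
      then have "f = f \<oplus> \<zero> \<otimes> x" using that(1) Bc xc by auto
      then show "f \<in> g F G" unfolding g_def using f that(2) by blast
    qed
    have g_mult: "a \<otimes> x \<in> g F G" if "\<zero> \<in> F" "a \<in> G" "G \<subseteq> B" for F G a
    proof -
      have "a \<otimes> x = \<zero> \<oplus> a \<otimes> x" using that Bc xc by auto
      then show ?thesis unfolding g_def using that by blast
    qed
    \<comment> \<open>\<open>F\<close> is recovered from \<open>F + Gx\<close> by intersecting with
      \<open>B\<close>: if \<open>a x\<close> is in \<open>B\<close> then \<open>a\<close> is in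
      \<open>I\<close>, so \<open>a x\<close> is in \<open>I\<close> and thus in \<open>F\<close>.
      This makes the passage from \<open>F\<close> to \<open>F + Bx\<close> injective.\<close>
    have g_inter: "g F G \<inter> B \<subseteq> F" if F: "subring F R" "V' \<subseteq> F" "F \<subseteq> B" and G: "G \<subseteq> B" for F G
    proof
      fix z assume z: "z \<in> g F G \<inter> B"
      then obtain f a where fa: "f \<in> F" "a \<in> G" "z = f \<oplus> a \<otimes> x" unfolding g_def by blast
      have c: "f \<in> carrier R" "a \<in> carrier R" using fa F(3) G Bc by auto
      have "a \<otimes> x = z \<ominus> f" unfolding fa(3) using c xc by algebra
      then have "a \<otimes> x \<in> B" using subring_minus_closed[OF B(1), of z f] z fa(1) F(3) by auto
      then have "a \<otimes> x \<in> F" using multx fa(2) G Ix IV' F(2) by blast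
      then show "z \<in> F" unfolding fa(3) using subringE(7)[OF F(1) fa(1)] by blast
    qed
    have g_C: "g F G \<subseteq> C" if "F \<subseteq> B" "G \<subseteq> B" for F G
      unfolding g_def using that C(2) x CE(6,7) by blast
    define L where "L = interm_rings T R"
    have LI: "W \<in> L" if "subring W R" "V' \<subseteq> W" for W
      using that V(2) VV' unfolding L_def interm_rings_def by blast
    have LD: "subring W R" if "W \<in> L" for W
      using that unfolding L_def interm_rings_def by blast
    have FCP: "finite K" if "subset.chain L K" for K
      using cat that unfolding catenarian_def FCP_def L_def by blast
    have "subset.chain L {V', B, C}"
      using LI[OF V'] LI[OF B(1) V'B] LI[OF C(1)] V'B C(2) unfolding subset_chain_def by auto
    then obtain D where D: "subset.maxchain L D" "{V', B, C} \<subseteq> D"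
      by (rule chain_extends_to_maxchain)
    then have chD: "subset.chain L D" unfolding subset.maxchain_def by blast
    have comp: "F \<subseteq> G \<or> G \<subseteq> F" if "F \<in> D" "G \<in> D" for F G
      using chD that unfolding subset_chain_def by blast
    have DL: "F \<in> L" if "F \<in> D" for F using chD that unfolding subset_chain_def by blast
    note finD = FCP[OF chD]
    define D1 where "D1 = {F \<in> D. F \<subseteq> V'}"
    define D2 where "D2 = {F \<in> D. V' \<subseteq> F \<and> F \<subseteq> B}"
    define D3 where "D3 = {F \<in> D. C \<subseteq> F}"
    \<comment> \<open>As \<open>D\<close> passes through \<open>V'\<close>, \<open>B\<close> and
      \<open>C\<close>, and \<open>C\<close> covers \<open>B\<close>, three segments exhaust it;
      \<open>V'\<close> is counted in the first and \<open>B\<close> in the second.\<close>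
    have D_eq: "D = (D1 \<union> (D2 - {V'})) \<union> D3"
    proof
      show "D \<subseteq> (D1 \<union> (D2 - {V'})) \<union> D3"
      proof
        fix F assume F: "F \<in> D"
        have "F \<subseteq> V' \<or> V' \<subseteq> F" "F \<subseteq> B \<or> B \<subseteq> F" "F \<subseteq> C \<or> C \<subseteq> F"
          using comp[OF F] D(2) by auto
        moreover have "F = B \<or> F = C" if "B \<subseteq> F" "F \<subseteq> C"
          using cover LD[OF DL[OF F]] that by blast
        ultimately show "F \<in> (D1 \<union> (D2 - {V'})) \<union> D3"
          unfolding D1_def D2_def D3_def using F by blast
      qed
    qed (auto simp: D1_def D2_def D3_def)
    have fin: "finite D1" "finite D2" "finite D3"
      using finD unfolding D1_def D2_def D3_def by auto
    have D2: "V' \<in> D2" "B \<in> D2" using D(2) V'B unfolding D2_def by auto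
    have card_D: "card D = card D1 + card (D2 - {V'}) + card D3"
    proof -
      have "D1 \<inter> (D2 - {V'}) = {}" unfolding D1_def D2_def by blast
      moreover have "(D1 \<union> (D2 - {V'})) \<inter> D3 = {}"
        unfolding D1_def D2_def D3_def using C(2) V'B by blast
      ultimately show ?thesis using D_eq fin by (metis card_Un_disjoint finite_Diff finite_Un)
    qed
    define W0 where "W0 = g V' V'"
    \<comment> \<open>\<open>F = B\<close> is left out because \<open>B + Bx = C\<close> is already
      in \<open>D3\<close>, whereas \<open>F = V'\<close> is kept. So \<open>G2\<close> has as many
      members as the segment it replaces, and \<open>W0\<close>, strictly below
      \<open>V' + Bx\<close>, is the surplus one.\<close>
    define G2 where "G2 = (\<lambda>F. g F B) ` (D2 - {B})"
    define E where "E = insert W0 ((D1 \<union> G2) \<union> D3)"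
    have D2E: "subring F R" "V' \<subseteq> F" "F \<subseteq> B" if "F \<in> D2" for F
      using that LD DL unfolding D2_def by auto
    have g_D2: "g F B \<inter> B = F" if "F \<in> D2" for F
      using g_inter[OF D2E[OF that], of B] g_upper[OF D2E(3)[OF that] BE(2)] D2E(3)[OF that] by blast
    have x_W0: "x \<in> W0"
      using g_mult[OF V'E(2,3) V'B] xc unfolding W0_def by simp
    have x_G: "x \<in> g F B" if "F \<in> D2" for F
      using g_mult[OF subringE(2)[OF D2E(1)[OF that]] BE(3)] xc by simp
    have W0_sub: "W0 \<subseteq> g V' B" unfolding W0_def g_def using V'B by blast
    have W0_B: "\<not> B \<subseteq> W0"
      using g_inter[OF V' _ V'B V'B] V'B V'neB unfolding W0_def by blast
    \<comment> \<open>An \<open>a\<close> in \<open>B\<close> outside \<open>V'\<close> has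
      \<open>a x\<close> in every \<open>F + Bx\<close>. Were \<open>a x\<close> in
      \<open>V' + V'x\<close>, its coefficient \<open>d\<close> there would differ from
      \<open>a\<close> by an element of \<open>I \<subseteq> V'\<close>.\<close>
    have W0_G2: "W0 \<noteq> g F B" if F: "F \<in> D2" for F
    proof
      assume eq: "W0 = g F B"
      obtain a where a: "a \<in> B" "a \<notin> V'" using V'B V'neB by blast
      have "a \<otimes> x \<in> W0" using g_mult[OF subringE(2)[OF D2E(1)[OF F]] a(1)] eq by simp
      then obtain f d where fd: "f \<in> V'" "d \<in> V'" "a \<otimes> x = f \<oplus> d \<otimes> x"
        unfolding W0_def g_def by blast
      have c: "a \<in> carrier R" "f \<in> carrier R" "d \<in> carrier R" using a fd V'B Bc by auto
      have "(a \<ominus> d) \<otimes> x = a \<otimes> x \<ominus> d \<otimes> x" using c xc by algebra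
      also have "\<dots> = f" unfolding fd(3) using c xc by algebra
      finally have "(a \<ominus> d) \<otimes> x \<in> B" using fd V'B by auto
      then have "a \<ominus> d \<in> V'"
        using multx subring_minus_closed[OF B(1) a(1)] fd(2) V'B IV' by blast
      then have "(a \<ominus> d) \<oplus> d \<in> V'" using V'E(7) fd(2) by blast
      moreover have "(a \<ominus> d) \<oplus> d = a" using c by algebra
      ultimately show False using a(2) by simp
    qed
    have card_G2: "card G2 = card (D2 - {V'})"
    proof -
      have "inj_on (\<lambda>F. g F B) (D2 - {B})"
        using g_D2 by (intro inj_onI) (metis DiffD1)
      then have "card G2 = card (D2 - {B})" unfolding G2_def by (rule card_image)
      then show ?thesis using D2 fin(2) by (simp add: card_Diff_singleton)
    qed
    have G2_props: "x \<in> G" "\<not> B \<subseteq> G" "W0 \<noteq> G" "W0 \<subseteq> G" "V' \<subseteq> G" "G \<subseteq> C" "G \<in> L"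
      if G: "G \<in> G2" for G
    proof -
      obtain F where F: "F \<in> D2" "F \<noteq> B" "G = g F B" using G unfolding G2_def by blast
      note FE = D2E[OF F(1)]
      show "x \<in> G" "W0 \<noteq> G" unfolding F(3) using x_G[OF F(1)] W0_G2[OF F(1)] by auto
      show "\<not> B \<subseteq> G" using g_D2[OF F(1)] F(2,3) by blast
      show "W0 \<subseteq> G" using W0_sub FE(2) unfolding F(3) g_def by blast
      show V'G: "V' \<subseteq> G" using g_upper[OF FE(3) BE(2)] FE(2) F(3) by blast
      show "G \<subseteq> C" using g_C[OF FE(3)] F(3) by blast
      show "G \<in> L" using LI[OF g_subring[OF FE B(1) FE(3)]] V'G F(3) by blast
    qed
    have W0_props: "V' \<subseteq> W0" "W0 \<subseteq> C" "W0 \<in> L"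
    proof -
      show "V' \<subseteq> W0" unfolding W0_def using g_upper[OF V'B V'E(2)] .
      then show "W0 \<in> L" using LI g_subring[OF V' _ V'B V' _ V'B] unfolding W0_def by blast
      show "W0 \<subseteq> C" unfolding W0_def using g_C[OF V'B V'B] .
    qed
    have D3_B: "B \<subseteq> F" "x \<in> F" if "F \<in> D3" for F
      using that C(2) x(1) unfolding D3_def by auto
    have D1_x: "x \<notin> F" if "F \<in> D1" for F
      using that V'B x(2) unfolding D1_def by blast
    have card_E: "card E = Suc (card D)"
    proof -
      have "D1 \<inter> G2 = {}" using D1_x G2_props(1) by blast
      moreover have "(D1 \<union> G2) \<inter> D3 = {}" using D1_x D3_B G2_props(2) by blast
      moreover have "W0 \<notin> (D1 \<union> G2) \<union> D3" using D1_x x_W0 D3_B(1) W0_B G2_props(3) by blast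
      moreover have "finite G2" unfolding G2_def using fin by simp
      ultimately show ?thesis
        unfolding E_def using fin card_D card_G2 by (simp add: card_Un_disjoint)
    qed
    have "subset.chain L E"
      unfolding subset_chain_def
    proof (intro conjI ballI)
      show "E \<subseteq> L"
        using W0_props(3) G2_props(7) DL unfolding E_def D1_def D3_def by blast
      have low: "F \<subseteq> V'" if "F \<in> D1" for F using that unfolding D1_def by blast
      have high: "C \<subseteq> F" if "F \<in> D3" for F using that unfolding D3_def by blast
      have G2_comp: "F \<subseteq> G \<or> G \<subseteq> F" if FG: "F \<in> G2" "G \<in> G2" for F G
      proof -
        obtain F' G' where *: "F' \<in> D2" "G' \<in> D2" "F = g F' B" "G = g G' B"
          using FG unfolding G2_def by blast
        then have "F' \<subseteq> G' \<or> G' \<subseteq> F'" using comp unfolding D2_def by blast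
        then show ?thesis unfolding * g_def by blast
      qed
      have DD: "F \<subseteq> G \<or> G \<subseteq> F" if "F \<in> D1 \<union> D3" "G \<in> D1 \<union> D3" for F G
        using comp that unfolding D1_def D3_def by blast
      fix F G assume "F \<in> E" "G \<in> E"
      then consider "F \<in> D1 \<union> D3" "G \<in> D1 \<union> D3" | "F \<in> D1" "G \<in> insert W0 G2"
        | "F \<in> D3" "G \<in> insert W0 G2" | "F \<in> insert W0 G2" "G \<in> D1" | "F \<in> insert W0 G2" "G \<in> D3"
        | "F \<in> insert W0 G2" "G \<in> insert W0 G2"
        unfolding E_def by blast
      then show "F \<subseteq> G \<or> G \<subseteq> F"
      proof cases
        case 1 then show ?thesis by (rule DD)
      next
        case 2 then show ?thesis using low W0_props(1) G2_props(5) by blast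
      next
        case 3 then show ?thesis using high W0_props(2) G2_props(6) by blast
      next
        case 4 then show ?thesis using low W0_props(1) G2_props(5) by blast
      next
        case 5 then show ?thesis using high W0_props(2) G2_props(6) by blast
      next
        case 6 then show ?thesis using G2_comp G2_props(4) by blast
      qed
    qed
    then obtain E' where E': "subset.maxchain L E'" "E \<subseteq> E'"
      by (rule chain_extends_to_maxchain)
    then have "finite E'" using FCP unfolding subset.maxchain_def by blast
    then have "card E \<le> card E'" using E'(2) by (rule card_mono)
    moreover have "card E' - 1 = card D - 1"
      using cat E'(1) D(1) unfolding catenarian_def chain_length_def L_def by blast
    \<comment> \<open>Length is cardinality minus one with truncated subtraction, so
      \<open>D\<close> must be nonempty for equal lengths to give equal cardinalities.\<close>
    moreover have "card D \<noteq> 0" using D(2) finD by auto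
    ultimately show False using card_E by linarith
  qed
  then obtain v i where vi: "v \<in> V" "i \<in> I" "b = v \<oplus> i" using b unfolding V'_def by blast
  have "v \<in> carrier R" "i \<in> carrier R" using vi VE(1) IB Bc by auto
  then have "b \<ominus> v = i" unfolding vi(3) by algebra
  then show ?thesis using vi I_def by auto
qed

text \<open>A maximal \<open>B\<close> above \<open>U\<close> whose conductor stays in
  \<open>N\<close>, together with a cover \<open>C\<close> of it, brings the conductor of
  \<open>B\<close> in \<open>C\<close> into \<open>N\<close>. Residual triviality of
  \<open>U\<close> then approximates \<open>y\<close> modulo \<open>N\<close> by an element of
  \<open>B\<close>, and \<open>catenarian_cover_residue\<close> approximates that one by an element
  of \<open>V\<close>.\<close>

lemma (in cring) catenarian_residually_trivial:
  assumes cat: "catenarian T R"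
    and U: "U \<in> interm_rings T R" "infra_integral U R"
    and V: "V \<in> interm_rings T R" "V \<subseteq> U"
    and N: "primeideal N R" "conductor U R \<subseteq> N"
  shows "residually_trivial_at V R N"
proof -
  interpret N: primeideal N R by (rule N(1))
  have Us: "subring U R" and Vs: "subring V R" "T \<subseteq> V"
    using U(1) V(1) unfolding interm_rings_def by auto
  have inf: "integral_extension U R" "\<forall>N. primeideal N R \<longrightarrow> residually_trivial_at U R N"
    using U(2) infra_integral_iff[OF is_cring Us] by auto
  have one: "\<one> \<notin> N" using N.one_imp_carrier N.I_notcarr by blast
  have FCP: "FCP U R"
    using cat U(1) FCP_mono[of T R U] unfolding catenarian_def interm_rings_def by blast
  let ?A = "{B \<in> interm_rings U R. conductor B R \<subseteq> N}"
  have "U \<in> ?A" using Us N(2) unfolding interm_rings_def by blast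
  then obtain B where B: "B \<in> ?A" and maxB: "\<And>W. W \<in> ?A \<Longrightarrow> B \<subseteq> W \<Longrightarrow> W = B"
    using FCP_exists_maximal[OF FCP, of ?A] by blast
  have Bs: "subring B R" "U \<subseteq> B" and BN: "conductor B R \<subseteq> N"
    using B unfolding interm_rings_def by auto
  have "B \<noteq> carrier R"
  proof
    assume "B = carrier R"
    then have "\<one> \<in> conductor B R" unfolding conductor_def by simp
    then show False using BN one by blast
  qed
  then have "carrier R \<in> {C \<in> interm_rings U R. B \<subset> C}"
    using subringE(1)[OF Bs(1)] subringE(1)[OF Us] carrier_is_subring
    unfolding interm_rings_def by blast
  then obtain C where C: "C \<in> {C \<in> interm_rings U R. B \<subset> C}"
    and minC: "\<And>W. W \<in> {C \<in> interm_rings U R. B \<subset> C} \<Longrightarrow> W \<subseteq> C \<Longrightarrow> W = C"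
    using FCP_exists_minimal[OF FCP, of "{C \<in> interm_rings U R. B \<subset> C}"] by blast
  have Cs: "subring C R" "B \<subset> C" using C unfolding interm_rings_def by auto
  have cover: "\<forall>W. subring W R \<longrightarrow> B \<subseteq> W \<longrightarrow> W \<subseteq> C \<longrightarrow> W = B \<or> W = C"
  proof (intro allI impI)
    fix W assume W: "subring W R" "B \<subseteq> W" "W \<subseteq> C"
    then show "W = B \<or> W = C" using minC[of W] Bs(2) unfolding interm_rings_def by blast
  qed
  have "C \<notin> ?A" using maxB[of C] Cs(2) by blast
  then obtain d where d: "d \<in> conductor C R" "d \<notin> N" using C by blast
  define I where "I = {a \<in> C. \<forall>r \<in> C. a \<otimes> r \<in> B}"
  \<comment> \<open>By maximality of \<open>B\<close> the conductor of \<open>C\<close> contains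
    \<open>d\<close> outside \<open>N\<close>. For \<open>i\<close> in \<open>I\<close> the product
    \<open>i d\<close> multiplies \<open>R\<close> into \<open>iC\<close>, hence into
    \<open>B\<close>, so it is in \<open>N\<close>, and primality applies.\<close>
  have IN: "I \<subseteq> N"
  proof
    fix i assume i: "i \<in> I"
    have ic: "i \<in> carrier R" using i subringE(1)[OF Cs(1)] unfolding I_def by blast
    have dc: "d \<in> carrier R" "\<And>r. r \<in> carrier R \<Longrightarrow> d \<otimes> r \<in> C"
      using d(1) unfolding conductor_def by auto
    have "i \<otimes> d \<otimes> r \<in> B" if "r \<in> carrier R" for r
      using i dc(2)[OF that] m_assoc[OF ic dc(1) that] unfolding I_def by simp
    then have "i \<otimes> d \<in> conductor B R" using ic dc(1) unfolding conductor_def by blast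
    then show "i \<in> N" using BN N.I_prime[OF ic dc(1)] d(2) by blast
  qed
  obtain x I' where "x \<in> C" "x \<notin> B" and I': "I' = {a \<in> C. \<forall>r \<in> C. a \<otimes> r \<in> B}"
    and "I' \<subseteq> B" and "ideal I' (R\<lparr>carrier := C\<rparr>)" "primeideal I' (R\<lparr>carrier := B\<rparr>)"
    and "x \<otimes> x \<in> I' \<or> x \<otimes> x \<ominus> x \<in> I'"
    and "\<forall>c \<in> C. \<exists>b \<in> B. \<exists>d \<in> B. c = b \<oplus> d \<otimes> x"
    and "\<forall>b \<in> B. b \<otimes> x \<in> B \<longrightarrow> b \<in> I'"
    and inv: "\<forall>a \<in> B. a \<notin> I' \<longrightarrow> (\<exists>b \<in> B. a \<otimes> b \<ominus> \<one> \<in> I')"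
    by (rule cover_structure[OF Us inf Bs Cs cover])
  have I'N: "I' \<subseteq> N" using IN unfolding I' I_def .
  have inv': "\<exists>s \<in> carrier R. a \<otimes> s \<ominus> \<one> \<in> N" if "a \<in> B" "a \<notin> N" for a
    using inv that I'N subringE(1)[OF Bs(1)] by blast
  show ?thesis
    unfolding residually_trivial_at_def
  proof
    fix y assume y: "y \<in> carrier R"
    obtain t where t: "t \<in> B" "y \<ominus> t \<in> N"
      using residue_surj[OF Bs(1) integral_extension_mono[OF inf(1) Bs(2)] N.ideal_axioms
          residually_trivial_at_mono[OF inf(2)[rule_format, OF N(1)] Bs(2)] inv' y] by blast
    obtain v where v: "v \<in> V" "t \<ominus> v \<in> N"
      using catenarian_cover_residue[OF cat Us inf Bs Cs cover Vs _ t(1)] V(2) Bs(2) IN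
      unfolding I_def by blast
    have c: "t \<in> carrier R" "v \<in> carrier R"
      using t v subringE(1)[OF Bs(1)] subringE(1)[OF Vs(1)] by auto
    have "\<one> \<otimes> y \<ominus> v = (y \<ominus> t) \<oplus> (t \<ominus> v)" using c y by algebra
    then have "\<one> \<otimes> y \<ominus> v \<in> N" using N.a_closed t v by simp
    then show "\<exists>s \<in> V - N. \<exists>b \<in> V. s \<otimes> y \<ominus> b \<in> N"
      using subringE(3)[OF Vs(1)] one v(1) by blast
  qed
qed

text \<open>
  At a prime containing neither conductor, a product \<open>u \<otimes> v\<close> of elements of the two conductors outside
  the prime multiplies the whole ring into the intersection.
\<close>

lemma (in cring) catenarian_infra_integral_inter:
  assumes cat: "catenarian T R" and int: "integral_extension T R"
    and U: "U \<in> interm_rings T R" "infra_integral U R"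
    and V: "V \<in> interm_rings T R" "infra_integral V R"
  shows "infra_integral (U \<inter> V) R"
proof -
  have s: "subring U R" "T \<subseteq> U" "subring V R" "T \<subseteq> V"
    using U(1) V(1) unfolding interm_rings_def by auto
  have UVs: "subring (U \<inter> V) R" using subring_inter s by blast
  have UV: "U \<inter> V \<in> interm_rings T R" using UVs s unfolding interm_rings_def by blast
  have "residually_trivial_at (U \<inter> V) R N" if N: "primeideal N R" for N
  proof (cases "conductor U R \<subseteq> N \<or> conductor V R \<subseteq> N")
    case True
    then show ?thesis
      using catenarian_residually_trivial[OF cat U UV _ N]
        catenarian_residually_trivial[OF cat V UV _ N] by blast
  next
    case False
    interpret N: primeideal N R by (rule N)
    obtain u v where uv: "u \<in> conductor U R" "u \<notin> N" "v \<in> conductor V R" "v \<notin> N"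
      using False by blast
    have c: "u \<in> carrier R" "v \<in> carrier R" using uv unfolding conductor_def by auto
    have "u \<otimes> v \<notin> N" using N.I_prime[OF c] uv by blast
    have mem: "(u \<otimes> v) \<otimes> y \<in> U \<inter> V" if y: "y \<in> carrier R" for y
    proof -
      have "(u \<otimes> v) \<otimes> y = u \<otimes> (v \<otimes> y)" "(u \<otimes> v) \<otimes> y = v \<otimes> (u \<otimes> y)"
        using c y by (simp_all add: m_ac)
      moreover have "u \<otimes> (v \<otimes> y) \<in> U" "v \<otimes> (u \<otimes> y) \<in> V"
        using uv(1,3) c y unfolding conductor_def by auto
      ultimately show ?thesis by (metis IntI)
    qed
    show ?thesis
      unfolding residually_trivial_at_def
    proof
      fix y assume y: "y \<in> carrier R"
      have "(u \<otimes> v) \<otimes> y \<ominus> (u \<otimes> v) \<otimes> y \<in> N"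
        using N.zero_closed c y by (simp add: a_minus_def r_neg)
      moreover have "u \<otimes> v \<in> U \<inter> V" using mem[OF one_closed] c by simp
      ultimately show "\<exists>s \<in> U \<inter> V - N. \<exists>b \<in> U \<inter> V. s \<otimes> y \<ominus> b \<in> N"
        using \<open>u \<otimes> v \<notin> N\<close> mem[OF y] by blast
    qed
  qed
  moreover have "integral_extension (U \<inter> V) R"
    using integral_extension_mono[OF int] s by blast
  ultimately show ?thesis using infra_integral_iff[OF is_cring UVs] by blast
qed

section \<open>The family of infra-integral subrings and its least member\<close>

lemma (in cring) infra_integral_carrier:
  assumes "integral_extension T R" "T \<subseteq> carrier R"
  shows "infra_integral (carrier R) R"
proof -
  have "residually_trivial_at (carrier R) R N" if N: "primeideal N R" for N
    unfolding residually_trivial_at_def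
  proof
    interpret N: primeideal N R by (rule N)
    fix y assume y: "y \<in> carrier R"
    have "\<one> \<in> carrier R - N" using N.one_imp_carrier N.I_notcarr by blast
    moreover have "\<one> \<otimes> y \<ominus> y \<in> N" using N.zero_closed y by (simp add: a_minus_def r_neg)
    ultimately show "\<exists>s \<in> carrier R - N. \<exists>b \<in> carrier R. s \<otimes> y \<ominus> b \<in> N" using y by blast
  qed
  then show ?thesis
    using infra_integral_iff[OF is_cring carrier_is_subring] integral_extension_mono[OF assms]
    by blast
qed

theorem theorem6p21:
  fixes S :: "('a, 'b) ring_scheme" and R T :: "'a set"
  assumes "cring S" and "subring R S" and "R \<subset> carrier S"
    and "integral_extension R S" and "FCP R S"
    and T_def: "T = \<Inter>{U \<in> interm_rings R S. infra_integral U S}"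
  shows "((\<exists>V. is_co_infra_integral_closure R S V) \<longleftrightarrow> infra_integral T S) \<and>
         (infra_integral T S \<longleftrightarrow> catenarian T S) \<and>
         (infra_integral T S \<longrightarrow> is_co_infra_integral_closure R S T)"
proof -
  interpret cring S by fact
  let ?F = "{U \<in> interm_rings R S. infra_integral U S}"
  \<comment> \<open>The family is thus nonempty, which makes its intersection \<open>T\<close> a
    subring.\<close>
  have top: "carrier S \<in> ?F"
    using infra_integral_carrier[OF assms(4)] assms(3) carrier_is_subring
    unfolding interm_rings_def by blast
  have "subring T S"
    unfolding T_def using top by (intro subring_Inter) (auto simp: interm_rings_def)
  moreover have RT: "R \<subseteq> T" unfolding T_def interm_rings_def by blast
  ultimately have TR: "T \<in> interm_rings R S" unfolding interm_rings_def by blast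
  have closure: "is_co_infra_integral_closure R S T" if "infra_integral T S"
    using that TR unfolding is_co_infra_integral_closure_def T_def by blast
  have infra: "infra_integral T S" if V: "is_co_infra_integral_closure R S V" for V
  proof -
    have "T = V" using V unfolding is_co_infra_integral_closure_def T_def by blast
    then show ?thesis using V unfolding is_co_infra_integral_closure_def by blast
  qed
  have FCP: "FCP T S" using FCP_mono[OF assms(5) RT] .
  have cat: "catenarian T S" if "infra_integral T S"
    using infra_integral_imp_catenarian[OF \<open>subring T S\<close> that FCP] .
  have "infra_integral T S" if cat: "catenarian T S"
  proof -
    \<comment> \<open>Members of the family contain \<open>T\<close>, so they lie in
      \<open>[T, S]\<close>, where catenarity is available.\<close>
    have FT: "U \<in> interm_rings T S" if "U \<in> ?F" for U
      using that unfolding T_def interm_rings_def by blast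
    \<comment> \<open>FCP gives a minimal member; closure under intersection makes it the least one,
      so it coincides with \<open>T\<close>.\<close>
    obtain M where M: "M \<in> ?F" and min: "\<And>W. W \<in> ?F \<Longrightarrow> W \<subseteq> M \<Longrightarrow> W = M"
      using FCP_exists_minimal[OF assms(5), of ?F] top by blast
    have "M \<subseteq> U" if U: "U \<in> ?F" for U
    proof -
      have "infra_integral (M \<inter> U) S"
        using catenarian_infra_integral_inter[OF cat integral_extension_mono[OF assms(4) RT]
            FT[OF M] _ FT[OF U]] M U by blast
      moreover have "M \<inter> U \<in> interm_rings R S"
        using M U subring_inter unfolding interm_rings_def by blast
      ultimately show ?thesis using min[of "M \<inter> U"] by blast
    qed
    then have "T = M" using M unfolding T_def by blast
    then show ?thesis using M by blast
  qed
  then show ?thesis using closure infra cat by blast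
qed

end
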